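(* For any Riemannian metric $g$ on the $2$-torus $\mathbb{T}^2$, there exists $\lambda\in\mathcal{C}^\infty(S\mathbb{T}^2,\mathbb{R})$ such that the thermostat $(\mathbb{T}^2,g,\lambda)$ has no conjugate points. Moreover, the function $\lambda$ can always be chosen such that $\lambda_0\neq 0$ (that is, $\lambda_0$ does not vanish identically).
   Context: A thermostat $(M,g,\lambda)$ consists of a closed oriented Riemannian surface $(M,g)$ and a function $\lambda\in\mathcal{C}^\infty(SM,\mathbb{R})$, where $\pi:SM\to M$ is the unit tangent bundle. Let $X$ be the geodesic vector field on $SM$ and $V$ the vertical vector field (generator of the rotations of the fibers). The thermostat flow $\varphi_t$ on $SM$ is the flow of $F:=X+\lambda V$; its orbits are $(\gamma,\dot\gamma)$ with $\nabla_{\dot\gamma}\dot\gamma=\lambda(\gamma,\dot\gamma)J\dot\gamma$, where $\nabla$ is the Levi-Civita connection and $J$ is rotation by $\pi/2$. The exponential map is $\exp^\lambda_x(tv):=\pi(\varphi_t(x,v))$ for $x\in M$, $t\ge 0$, $v\in S_xM$ (it is $\mathcal{C}^\infty$ on $T_xM\setminus\{0\}$ and $\mathcal{C}^1$ at $0$). The thermostat has no conjugate points if $\exp_x^\lambda:T_xM\to M$ is a local diffeomorphism for all $x\in M$. $\lambda_0$ denotes the zeroth Fourier mode of $\lambda$ with respect to the circle action on the fibers of $SM$, i.e. the average of $\lambda$ over each fiber $S_xM$, regarded as a function of $x\in M$ (the magnetic component of $\lambda$). *)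

theory Defs
  imports "HOL-Analysis.Analysis"
begin

section \<open>Maps of class \<open>C\<^sup>k\<close>\<close>

text \<open>Meant for open \<open>S\<close>.\<close>

fun Ck_on :: "nat \<Rightarrow> ('a::euclidean_space \<Rightarrow> 'b::real_normed_vector) \<Rightarrow> 'a set \<Rightarrow> bool" where
  "Ck_on 0 f S \<longleftrightarrow> continuous_on S f"
| "Ck_on (Suc k) f S \<longleftrightarrow>
     (\<forall>x\<in>S. f differentiable (at x)) \<and>
     (\<forall>v. Ck_on k (\<lambda>x. frechet_derivative f (at x) v) S)"

definition smooth_on :: "('a::euclidean_space \<Rightarrow> 'b::real_normed_vector) \<Rightarrow> 'a set \<Rightarrow> bool" where
  "smooth_on f S \<longleftrightarrow> (\<forall>k. Ck_on k f S)"

text \<open>Smoothness on an arbitrary subset of a Euclidean space, via local smooth extensions.  On an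
  embedded submanifold this is smoothness with respect to the submanifold structure.\<close>

definition smooth_on_subset :: "('a::euclidean_space \<Rightarrow> 'b::real_normed_vector) \<Rightarrow> 'a set \<Rightarrow> bool" where
  "smooth_on_subset f S \<longleftrightarrow>
     (\<forall>x\<in>S. \<exists>U h. open U \<and> x \<in> U \<and> smooth_on h U \<and> (\<forall>y\<in>S \<inter> U. h y = f y))"

section \<open>The torus as the quotient of the plane by the integer lattice\<close>

definition lattice_rel :: "real^2 \<Rightarrow> real^2 \<Rightarrow> bool" where
  "lattice_rel p q \<longleftrightarrow> (\<forall>i. p $ i - q $ i \<in> \<int>)"

lemma equivp_lattice_rel: "equivp lattice_rel"
proof (rule equivpI)
  show "reflp lattice_rel"
    by (simp add: reflp_def lattice_rel_def)
  show "symp lattice_rel"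
    by (auto simp: symp_def lattice_rel_def) (metis Ints_minus minus_diff_eq)
  show "transp lattice_rel"
  proof (rule transpI)
    fix p q r :: "real^2"
    assume "lattice_rel p q" "lattice_rel q r"
    then have "p $ i - r $ i \<in> \<int>" for i
      using Ints_add[of "p $ i - q $ i" "q $ i - r $ i"] by (simp add: lattice_rel_def)
    then show "lattice_rel p r"
      by (simp add: lattice_rel_def)
  qed
qed

quotient_type torus = "real^2" / lattice_rel morphisms torus_rep torus_proj
  by (rule equivp_lattice_rel)

text \<open>The quotient topology.\<close>

instantiation torus :: topological_space
begin

definition open_torus :: "torus set \<Rightarrow> bool" where
  "open_torus V \<longleftrightarrow> open (torus_proj -` V)"

instance
proof
  show "open (UNIV :: torus set)"
    by (simp add: open_torus_def)
  show "open (S \<inter> T)" if "open S" "open T" for S T :: "torus set"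
    using that by (simp add: open_torus_def vimage_Int open_Int)
  show "open (\<Union>K)" if "\<forall>S\<in>K. open S" for K :: "torus set set"
    using that unfolding open_torus_def vimage_Union by (intro open_UN) blast
qed

end

text \<open>Differential structure: \<open>torus_proj\<close> is a local diffeomorphism, so a map out of the torus has
  the regularity of its composition with \<open>torus_proj\<close>, and a map into the torus has the regularity
  of its local lifts.  The coordinate frame trivialises the tangent bundle, which is therefore
  \<^typ>\<open>torus \<times> (real^2)\<close>; the orientation is the standard one of this frame.\<close>

definition C1_to_torus_on :: "(real^2 \<Rightarrow> torus) \<Rightarrow> (real^2) set \<Rightarrow> bool" where
  "C1_to_torus_on f U \<longleftrightarrow>
     (\<forall>w\<in>U. \<exists>W c. open W \<and> w \<in> W \<and> W \<subseteq> U \<and> Ck_on 1 c W \<and> (\<forall>y\<in>W. f y = torus_proj (c y)))"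

definition C1_from_torus_on :: "(torus \<Rightarrow> real^2) \<Rightarrow> torus set \<Rightarrow> bool" where
  "C1_from_torus_on h V \<longleftrightarrow> Ck_on 1 (h \<circ> torus_proj) (torus_proj -` V)"

text \<open>Local diffeomorphism in the \<open>C\<^sup>1\<close> sense, since exponential maps of thermostats are in general
  only \<open>C\<^sup>1\<close> at the origin.\<close>

definition local_diffeo :: "(real^2 \<Rightarrow> torus) \<Rightarrow> bool" where
  "local_diffeo f \<longleftrightarrow>
     (\<forall>w. \<exists>U V h. open U \<and> w \<in> U \<and> open V \<and> f ` U = V \<and> (\<forall>y\<in>U. h (f y) = y) \<and>
        C1_to_torus_on f U \<and> C1_from_torus_on h V)"

text \<open>\<open>has_velocity c u t\<close>: the curve \<open>c\<close> in the tangent bundle is differentiable at \<open>t\<close> with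
  derivative \<open>u\<close>.\<close>

definition has_velocity :: "(real \<Rightarrow> torus \<times> (real^2)) \<Rightarrow> (real^2) \<times> (real^2) \<Rightarrow> real \<Rightarrow> bool" where
  "has_velocity c u t \<longleftrightarrow>
     (\<exists>p. (\<forall>\<^sub>F s in nhds t. fst (c s) = torus_proj (p s)) \<and>
        (p has_vector_derivative fst u) (at t)) \<and>
     ((\<lambda>s. snd (c s)) has_vector_derivative snd u) (at t)"

text \<open>Coordinate partial derivatives; the result does not depend on the representative.\<close>

definition torus_partial :: "2 \<Rightarrow> (torus \<Rightarrow> real) \<Rightarrow> torus \<Rightarrow> real" where
  "torus_partial i f x = frechet_derivative (f \<circ> torus_proj) (at (torus_rep x)) (axis i 1)"

section \<open>Riemannian geometry of the torus\<close>

text \<open>A metric is given by its Gram matrices in the coordinate frame.\<close>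

type_synonym metric = "torus \<Rightarrow> real^2^2"

definition metric_inner :: "metric \<Rightarrow> torus \<Rightarrow> real^2 \<Rightarrow> real^2 \<Rightarrow> real" where
  "metric_inner g x v w = v \<bullet> (g x *v w)"

definition metric_norm :: "metric \<Rightarrow> torus \<Rightarrow> real^2 \<Rightarrow> real" where
  "metric_norm g x v = sqrt (metric_inner g x v v)"

definition riemannian_metric :: "metric \<Rightarrow> bool" where
  "riemannian_metric g \<longleftrightarrow>
     smooth_on (g \<circ> torus_proj) UNIV \<and>
     (\<forall>x v w. metric_inner g x v w = metric_inner g x w v) \<and>
     (\<forall>x v. v \<noteq> 0 \<longrightarrow> metric_inner g x v v > 0)"

definition unit_tangent :: "metric \<Rightarrow> (torus \<times> (real^2)) set" where
  "unit_tangent g = {(x, v). metric_norm g x v = 1}"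

definition christoffel :: "metric \<Rightarrow> torus \<Rightarrow> 2 \<Rightarrow> 2 \<Rightarrow> 2 \<Rightarrow> real" where
  "christoffel g x k i j =
     (\<Sum>l\<in>UNIV. matrix_inv (g x) $ k $ l *
        (torus_partial i (\<lambda>y. g y $ j $ l) x + torus_partial j (\<lambda>y. g y $ i $ l) x
          - torus_partial l (\<lambda>y. g y $ i $ j) x)) / 2"

text \<open>Rotation by \<open>\<pi>/2\<close> with respect to the metric and the orientation, characterised by the lemma
  below.\<close>

definition rotJ :: "metric \<Rightarrow> torus \<Rightarrow> real^2 \<Rightarrow> real^2" where
  "rotJ g x v = (1 / sqrt (det (g x))) *\<^sub>R vector [- ((g x *v v) $ 2), (g x *v v) $ 1]"

lemma rotJ_characterization:
  assumes g: "riemannian_metric g" and v: "v \<noteq> 0"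
  shows "metric_inner g x v (rotJ g x v) = 0"
    and "metric_norm g x (rotJ g x v) = metric_norm g x v"
    and "v $ 1 * rotJ g x v $ 2 - v $ 2 * rotJ g x v $ 1 > 0"
proof -
  define a b c where "a = g x $ 1 $ 1" and "b = g x $ 1 $ 2" and "c = g x $ 2 $ 2"
  have sym: "g x $ 2 $ 1 = b"
  proof -
    have "metric_inner g x (axis 1 1) (axis 2 1) = metric_inner g x (axis 2 1) (axis 1 1)"
      using g by (simp add: riemannian_metric_def)
    then show ?thesis
      by (simp add: metric_inner_def inner_vec_def matrix_vector_mult_def sum_2 axis_def b_def)
  qed
  have pos: "metric_inner g x u u > 0" if "u \<noteq> 0" for u
    using g that by (simp add: riemannian_metric_def)
  have inner: "metric_inner g x u w =
      a * u $ 1 * w $ 1 + b * (u $ 1 * w $ 2 + u $ 2 * w $ 1) + c * u $ 2 * w $ 2" for u w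
    by (simp add: metric_inner_def inner_vec_def matrix_vector_mult_def sum_2 sym
        a_def[symmetric] b_def[symmetric] c_def[symmetric] algebra_simps)
  have a: "a > 0"
    using pos[of "axis 1 1"] by (simp add: inner axis_def vec_eq_iff)
  have nz: "(vector [- b, a] :: real^2) \<noteq> 0"
    using a by (auto simp: vec_eq_iff forall_2)
  have "a * (a * c - b * b) > 0"
    using pos[OF nz] by (simp add: inner algebra_simps)
  then have d: "a * c - b * b > 0"
    using a by (simp add: zero_less_mult_iff)
  have det: "det (g x) = a * c - b * b"
    by (simp add: det_2 sym a_def b_def c_def)
  define r where "r = sqrt (det (g x))"
  have r: "r > 0" and r2: "r * r = a * c - b * b"
    using d by (simp_all add: r_def det)
  have J1: "rotJ g x v $ 1 = - (b * v $ 1 + c * v $ 2) / r"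
    and J2: "rotJ g x v $ 2 = (a * v $ 1 + b * v $ 2) / r"
    by (simp_all add: rotJ_def r_def[symmetric] matrix_vector_mult_def sum_2 sym
        a_def b_def c_def)
  show "metric_inner g x v (rotJ g x v) = 0"
    using r by (simp add: inner J1 J2 field_simps)
  have "r * r * metric_inner g x (rotJ g x v) (rotJ g x v) = (a * c - b * b) * metric_inner g x v v"
    using r by (simp add: inner J1 J2 field_simps)
  then have "metric_inner g x (rotJ g x v) (rotJ g x v) = metric_inner g x v v"
    using r2 d by simp
  then show "metric_norm g x (rotJ g x v) = metric_norm g x v"
    by (simp add: metric_norm_def)
  have "v $ 1 * rotJ g x v $ 2 - v $ 2 * rotJ g x v $ 1 = metric_inner g x v v / r"
    using r by (simp add: inner J1 J2 field_simps)
  then show "v $ 1 * rotJ g x v $ 2 - v $ 2 * rotJ g x v $ 1 > 0"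
    using pos[OF v] r by simp
qed

section \<open>Thermostats\<close>

text \<open>A function on the unit tangent bundle is represented by a function on \<^typ>\<open>torus \<times> (real^2)\<close>
  whose values off \<open>unit_tangent g\<close> are irrelevant.\<close>

definition smooth_on_unit_tangent :: "metric \<Rightarrow> (torus \<times> (real^2) \<Rightarrow> real) \<Rightarrow> bool" where
  "smooth_on_unit_tangent g l \<longleftrightarrow>
     smooth_on_subset (\<lambda>(p, v). l (torus_proj p, v)) {(p, v). (torus_proj p, v) \<in> unit_tangent g}"

text \<open>The vector fields \<open>X\<close>, \<open>V\<close> and \<open>F = X + \<lambda>V\<close>, tangent to the unit tangent bundle.\<close>

definition geodesic_field :: "metric \<Rightarrow> torus \<times> (real^2) \<Rightarrow> (real^2) \<times> (real^2)" where
  "geodesic_field g = (\<lambda>(x, v).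
     (v, \<chi> k. - (\<Sum>i\<in>UNIV. \<Sum>j\<in>UNIV. christoffel g x k i j * v $ i * v $ j)))"

definition vertical_field :: "metric \<Rightarrow> torus \<times> (real^2) \<Rightarrow> (real^2) \<times> (real^2)" where
  "vertical_field g = (\<lambda>(x, v). (0, rotJ g x v))"

definition thermostat_field ::
    "metric \<Rightarrow> (torus \<times> (real^2) \<Rightarrow> real) \<Rightarrow> torus \<times> (real^2) \<Rightarrow> (real^2) \<times> (real^2)" where
  "thermostat_field g l z = geodesic_field g z + l z *\<^sub>R vertical_field g z"

definition is_thermostat_flow ::
    "metric \<Rightarrow> (torus \<times> (real^2) \<Rightarrow> real) \<Rightarrow> (real \<Rightarrow> torus \<times> (real^2) \<Rightarrow> torus \<times> (real^2)) \<Rightarrow> bool" where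
  "is_thermostat_flow g l \<phi> \<longleftrightarrow>
     (\<forall>z\<in>unit_tangent g. \<phi> 0 z = z \<and>
        (\<forall>t. \<phi> t z \<in> unit_tangent g \<and>
             has_velocity (\<lambda>s. \<phi> s z) (thermostat_field g l (\<phi> t z)) t))"

text \<open>\<open>exp\<^sub>x(tv) = \<pi>(\<phi>\<^sub>t(x,v))\<close> for \<open>t \<ge> 0\<close> and unit \<open>v\<close>.\<close>

definition thermostat_exp ::
    "metric \<Rightarrow> (real \<Rightarrow> torus \<times> (real^2) \<Rightarrow> torus \<times> (real^2)) \<Rightarrow> torus \<Rightarrow> real^2 \<Rightarrow> torus" where
  "thermostat_exp g \<phi> x w =
     (if w = 0 then x
      else fst (\<phi> (metric_norm g x w) (x, (1 / metric_norm g x w) *\<^sub>R w)))"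

text \<open>For smooth \<open>l\<close> the flow exists and is unique on the (compact) unit tangent bundle, so the
  existential quantifier merely names it.\<close>

definition no_conjugate_points :: "metric \<Rightarrow> (torus \<times> (real^2) \<Rightarrow> real) \<Rightarrow> bool" where
  "no_conjugate_points g l \<longleftrightarrow>
     (\<exists>\<phi>. is_thermostat_flow g l \<phi> \<and> (\<forall>x. local_diffeo (thermostat_exp g \<phi> x)))"

text \<open>The average over the fibre, parametrised by the circle action
  \<open>\<theta> \<mapsto> cos \<theta> v + sin \<theta> Jv\<close> on a unit vector \<open>v\<close>; the choice of \<open>v\<close> does not matter.\<close>

definition fourier0 :: "metric \<Rightarrow> (torus \<times> (real^2) \<Rightarrow> real) \<Rightarrow> torus \<Rightarrow> real" where
  "fourier0 g l x =
     (let v = (1 / metric_norm g x (axis 1 1)) *\<^sub>R axis 1 1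
      in integral {0..2 * pi} (\<lambda>\<theta>. l (x, cos \<theta> *\<^sub>R v + sin \<theta> *\<^sub>R rotJ g x v)) / (2 * pi))"

end

theory Submission
  imports Defs
begin

text \<open>Lift everything to the plane and take for orbits, reparametrised by the arc length of \<open>g\<close>, the
  curves \<open>c\<close> with \<open>c'' = (- |c'| c'\<^sub>2, 0)\<close>, i.e. catenaries with a common axis direction together
  with the straight lines in that direction.  The initial vector \<open>u\<close> is sent to the end point of
  the catenary arc over the parameter interval \<open>[0, 1]\<close> by a map with \<open>E\<^sub>2(u) = p\<^sub>2 + u\<^sub>2\<close> and
  \<open>\<partial>\<^sub>1 E\<^sub>1(u) \<ge> exp (- |u\<^sub>2|)\<close>, hence by a local diffeomorphism \<open>E\<close>.  Passing to arc length
  composes \<open>E\<close> with the inverse of a map \<open>H\<close> that preserves every ray from the origin and is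
  strictly increasing on it, and \<open>exp (H u) = E u\<close>.  Turning these curves into orbits adds to the
  \<open>\<lambda>\<close> of the straight lines, which is odd on fibres, the term
  \<open>sqrt (det g) |v| v\<^sub>2\<^sup>2\<close>, which is even and nonnegative, so that \<open>\<lambda>\<^sub>0 > 0\<close>.\<close>

section \<open>Closure properties of \<open>C\<^sup>k\<close> maps\<close>

text \<open>Straight lines alone settle the first claim, but their contribution averages to zero on
  every fibre, so the curves have to bend by an even amount without ever focusing. The equation for
  \<open>c\<close> achieves this through its form. It does not involve the position, so it descends
  to the torus. Its right-hand side is positively homogeneous of degree two, so scaling the initial
  velocity only rescales time; hence the curves issuing from a point depend on the direction alone.
  The second velocity component is constant, so the derivative of \<open>E\<close> is triangular
  with one diagonal entry equal to 1, and only the other one has to be kept away from 0. Finally,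
  velocity and acceleration span the area |v| v_2^2, which does not change sign under v -> -v. The
  metric enters only through the parametrisation of the curves. The price is the Euclidean norm in
  the equation: at the origin \<open>E\<close> is only of class C^1, which is why regularity there
  is studied in polar coordinates.\<close>

lemma Ck_on_cong:
  assumes "open S" "\<And>x. x \<in> S \<Longrightarrow> f x = g x"
  shows "Ck_on k f S \<longleftrightarrow> Ck_on k g S"
  using assms(2)
proof (induction k arbitrary: f g)
  case 0
  then show ?case by (simp cong: continuous_on_cong)
next
  case (Suc k)
  have d: "(f has_derivative D) (at x) \<longleftrightarrow> (g has_derivative D) (at x)" if "x \<in> S" for x D
    using has_derivative_transform_within_open[OF _ assms(1) that] Suc.prems by metis
  have e: "f differentiable (at x) \<longleftrightarrow> g differentiable (at x)" if "x \<in> S" for x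
    by (simp add: differentiable_def d[OF that])
  have "frechet_derivative f (at x) = frechet_derivative g (at x)" if "x \<in> S" for x
    by (simp add: frechet_derivative_def d[OF that])
  then have "Ck_on k (\<lambda>x. frechet_derivative f (at x) v) S \<longleftrightarrow>
      Ck_on k (\<lambda>x. frechet_derivative g (at x) v) S" for v
    by (intro Suc.IH) simp
  with e show ?case by simp
qed

text \<open>\<open>Ck_on\<close> is phrased with the choice operator
  \<open>frechet_derivative\<close>. This rule trades it for any explicit derivative, so that each
  closure proof below rests on one differentiation rule.\<close>

lemma Ck_on_SucI:
  assumes "open S" "\<And>x. x \<in> S \<Longrightarrow> (f has_derivative f' x) (at x)"
    and "\<And>v. Ck_on k (\<lambda>x. f' x v) S"
  shows "Ck_on (Suc k) f S"
proof -
  have "Ck_on k (\<lambda>x. frechet_derivative f (at x) v) S" for v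
    using assms(3)[of v]
    by (rule Ck_on_cong[OF assms(1), THEN iffD1, rotated])
      (simp add: frechet_derivative_at[OF assms(2), symmetric])
  then show ?thesis
    using assms(2) by (auto simp: differentiable_def)
qed

lemma Ck_on_SucD:
  assumes "Ck_on (Suc k) f S"
  shows "x \<in> S \<Longrightarrow> (f has_derivative frechet_derivative f (at x)) (at x)"
    and "Ck_on k (\<lambda>x. frechet_derivative f (at x) v) S"
  using assms by (simp_all add: frechet_derivative_works)

text \<open>The derivative of a product, a reciprocal or a root contains the undifferentiated
  function again, at one order less than assumed.\<close>

lemma Ck_on_Suc_imp: "Ck_on (Suc k) f S \<Longrightarrow> Ck_on k f S"
proof (induction k arbitrary: f)
  case 0
  then show ?case
    by (simp add: continuous_at_imp_continuous_on differentiable_imp_continuous_within)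
next
  case (Suc k)
  from Suc.prems show ?case
    by (subst Ck_on.simps(2), subst (asm) Ck_on.simps(2)) (intro conjI allI Suc.IH; blast)
qed

lemma Ck_on_const: "Ck_on k (\<lambda>x. c) S"
  by (induction k arbitrary: c) (auto simp: frechet_derivative_const)

lemma Ck_on_add:
  fixes f g :: "'a::euclidean_space \<Rightarrow> 'b::real_normed_vector"
  assumes "open S" "Ck_on k f S" "Ck_on k g S"
  shows "Ck_on k (\<lambda>x. f x + g x) S"
  using assms(2,3)
proof (induction k arbitrary: f g)
  case 0
  then show ?case by (auto intro: continuous_intros)
next
  case (Suc k)
  show ?case
    by (rule Ck_on_SucI[OF assms(1) has_derivative_add[OF Ck_on_SucD(1)[OF Suc.prems(1)]
          Ck_on_SucD(1)[OF Suc.prems(2)]]])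
      (assumption | rule Suc.IH Ck_on_SucD(2) Suc.prems)+
qed

lemma Ck_on_mult:
  fixes f g :: "'a::euclidean_space \<Rightarrow> real"
  assumes "open S" "Ck_on k f S" "Ck_on k g S"
  shows "Ck_on k (\<lambda>x. f x * g x) S"
  using assms(2,3)
proof (induction k arbitrary: f g)
  case 0
  then show ?case by (auto intro: continuous_intros)
next
  case (Suc k)
  show ?case
    by (rule Ck_on_SucI[OF assms(1) has_derivative_mult[OF Ck_on_SucD(1)[OF Suc.prems(1)]
          Ck_on_SucD(1)[OF Suc.prems(2)]]])
      (assumption | intro Ck_on_add assms(1) Suc.IH Suc.prems[THEN Ck_on_SucD(2)]
        Suc.prems[THEN Ck_on_Suc_imp])+
qed

lemma Ck_on_bounded_linear_compose:
  assumes "bounded_linear L" "open S" "Ck_on k f S"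
  shows "Ck_on k (\<lambda>x. L (f x)) S"
  using assms(3)
proof (induction k arbitrary: f)
  case 0
  then show ?case by (auto intro: bounded_linear.continuous_on[OF assms(1)])
next
  case (Suc k)
  show ?case
    by (rule Ck_on_SucI[OF assms(2) bounded_linear.has_derivative[OF assms(1)
          Ck_on_SucD(1)[OF Suc.prems]]]) (assumption | rule Suc.IH Ck_on_SucD(2) Suc.prems)+
qed

lemma Ck_on_compose_bounded_linear:
  assumes L: "bounded_linear L" and "open S" "L ` S \<subseteq> T" "Ck_on k f T"
  shows "Ck_on k (\<lambda>x. f (L x)) S"
  using assms(4)
proof (induction k arbitrary: f)
  case 0
  then show ?case
    using assms by (auto intro: continuous_on_compose2[OF _ linear_continuous_on[OF L]])
next
  case (Suc k)
  have "((\<lambda>x. f (L x)) has_derivative (\<lambda>v. frechet_derivative f (at (L x)) (L v))) (at x)"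
    if "x \<in> S" for x
    using that assms(3)
    by (intro has_derivative_compose[OF bounded_linear_imp_has_derivative[OF L]]
        Ck_on_SucD(1)[OF Suc.prems]) auto
  then show ?case
    by (rule Ck_on_SucI[OF assms(2)]) (assumption | rule Suc.IH Ck_on_SucD(2) Suc.prems)+
qed

lemma Ck_on_bounded_linear: "bounded_linear L \<Longrightarrow> open S \<Longrightarrow> Ck_on k L S"
proof -
  assume L: "bounded_linear L" and S: "open S"
  show ?thesis
  proof (cases k)
    case 0
    then show ?thesis using linear_continuous_on[OF L] by simp
  next
    case (Suc n)
    show ?thesis unfolding Suc
      by (rule Ck_on_SucI[OF S bounded_linear_imp_has_derivative[OF L] Ck_on_const])
  qed
qed

lemma Ck_on_inverse:
  fixes f :: "'a::euclidean_space \<Rightarrow> real"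
  assumes S: "open S" and nz: "\<And>x. x \<in> S \<Longrightarrow> f x \<noteq> 0" and f: "Ck_on k f S"
  shows "Ck_on k (\<lambda>x. inverse (f x)) S"
  using f
proof (induction k)
  case 0
  then show ?case using nz by (auto intro: continuous_intros)
next
  case (Suc k)
  \<comment> \<open>The sign is written as the factor \<open>- 1\<close> to make the derivative a
    pure product, to which \<open>Ck_on_mult\<close> applies.\<close>
  have d: "((\<lambda>x. inverse (f x)) has_derivative
      (\<lambda>v. - 1 * (inverse (f x) * frechet_derivative f (at x) v * inverse (f x)))) (at x)"
    if "x \<in> S" for x
    using Deriv.has_derivative_inverse[OF nz[OF that] Ck_on_SucD(1)[OF Suc.prems that]] by simp
  have i: "Ck_on k (\<lambda>x. inverse (f x)) S"
    by (rule Suc.IH[OF Ck_on_Suc_imp[OF Suc.prems]])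
  show ?case
    by (rule Ck_on_SucI[OF S d])
      (assumption | rule Ck_on_mult S Ck_on_const i Ck_on_SucD(2)[OF Suc.prems])+
qed

lemma Ck_on_sqrt:
  fixes f :: "'a::euclidean_space \<Rightarrow> real"
  assumes S: "open S" and pos: "\<And>x. x \<in> S \<Longrightarrow> f x > 0" and f: "Ck_on k f S"
  shows "Ck_on k (\<lambda>x. sqrt (f x)) S"
  using f
proof (induction k)
  case 0
  then show ?case by (auto intro: continuous_intros)
next
  case (Suc k)
  have d: "((\<lambda>x. sqrt (f x)) has_derivative
      (\<lambda>v. frechet_derivative f (at x) v * (inverse (sqrt (f x)) * (1 / 2)))) (at x)"
    if "x \<in> S" for x
    by (rule has_derivative_eq_rhs[OF has_derivative_real_sqrt[OF pos[OF that]
          Ck_on_SucD(1)[OF Suc.prems that]]]) (simp add: fun_eq_iff field_simps)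
  have i: "Ck_on k (\<lambda>x. inverse (sqrt (f x))) S"
    by (rule Ck_on_inverse[OF S _ Suc.IH[OF Ck_on_Suc_imp[OF Suc.prems]]])
      (use pos in fastforce)
  show ?case
    by (rule Ck_on_SucI[OF S d])
      (assumption | rule Ck_on_mult S Ck_on_const i Ck_on_SucD(2)[OF Suc.prems])+
qed

section \<open>Calculus of \<open>C\<^sup>1\<close> maps\<close>

text \<open>Continuity of the derivative in the operator norm is the form that the chain rule,
  differentiation under the integral and the inverse function theorem work with. For open sets in
  Euclidean spaces \<open>C1_on_iff_Ck_on_1\<close> translates it back.\<close>

definition C1_on :: "('a::real_normed_vector \<Rightarrow> 'b::real_normed_vector) \<Rightarrow> 'a set \<Rightarrow> bool" where
  "C1_on f S \<longleftrightarrow> (\<exists>f' :: 'a \<Rightarrow> 'a \<Rightarrow>\<^sub>L 'b.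
     (\<forall>x\<in>S. (f has_derivative blinfun_apply (f' x)) (at x)) \<and> continuous_on S f')"

lemma C1_onE:
  assumes "C1_on f S"
  obtains f' where "\<And>x. x \<in> S \<Longrightarrow> (f has_derivative blinfun_apply (f' x)) (at x)"
    "continuous_on S f'"
proof -
  obtain f' where "\<forall>x\<in>S. (f has_derivative blinfun_apply (f' x)) (at x)" "continuous_on S f'"
    using assms unfolding C1_on_def by (elim exE conjE)
  then show thesis by (intro that[of f']) simp_all
qed

lemma C1_onI_blinfun:
  assumes "\<And>x. x \<in> S \<Longrightarrow> (f has_derivative blinfun_apply (f' x)) (at x)"
    "continuous_on S f'"
  shows "C1_on f S"
  unfolding C1_on_def by (intro exI[of _ f'] conjI ballI assms)

text \<open>In finite dimension, continuity of the derivative on each basis vector is continuity in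
  the operator norm.\<close>

lemma C1_onI:
  fixes f :: "'a::euclidean_space \<Rightarrow> 'b::real_normed_vector"
  assumes d: "\<And>x. x \<in> S \<Longrightarrow> (f has_derivative D x) (at x)"
    and c: "\<And>i. i \<in> Basis \<Longrightarrow> continuous_on S (\<lambda>x. D x i)"
  shows "C1_on f S"
proof (rule C1_onI_blinfun)
  have eq: "blinfun_apply (Blinfun (D x)) = D x" if "x \<in> S" for x
    using has_derivative_bounded_linear[OF d[OF that]] by (rule bounded_linear_Blinfun_apply)
  show "(f has_derivative blinfun_apply (Blinfun (D x))) (at x)" if "x \<in> S" for x
    using d[OF that] by (simp add: eq[OF that])
  show "continuous_on S (\<lambda>x. Blinfun (D x))"
    using c by (intro continuous_on_blinfun_componentwise) (simp add: eq cong: continuous_on_cong)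
qed

lemma C1_on_iff_Ck_on_1:
  fixes f :: "'a::euclidean_space \<Rightarrow> 'b::real_normed_vector"
  assumes "open S"
  shows "C1_on f S \<longleftrightarrow> Ck_on 1 f S"
proof
  assume "C1_on f S"
  then obtain f' where d: "\<And>x. x \<in> S \<Longrightarrow> (f has_derivative blinfun_apply (f' x)) (at x)"
    and c: "continuous_on S f'"
    by (rule C1_onE) blast
  have "Ck_on (Suc 0) f S"
    by (rule Ck_on_SucI[OF assms d]) (use c in \<open>auto intro: continuous_intros\<close>)
  then show "Ck_on 1 f S" by simp
next
  assume "Ck_on 1 f S"
  then have *: "Ck_on (Suc 0) f S" by simp
  show "C1_on f S"
    using Ck_on_SucD[OF *] by (intro C1_onI[where D="\<lambda>x. frechet_derivative f (at x)"]) auto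
qed

lemma C1_on_subset: "C1_on f T \<Longrightarrow> S \<subseteq> T \<Longrightarrow> C1_on f S"
  by (elim C1_onE, rule C1_onI_blinfun) (auto intro: continuous_on_subset)

lemma C1_on_cong:
  assumes "open S" "\<And>x. x \<in> S \<Longrightarrow> f x = g x" "C1_on g S"
  shows "C1_on f S"
proof -
  obtain g' where d: "\<And>x. x \<in> S \<Longrightarrow> (g has_derivative blinfun_apply (g' x)) (at x)"
    and c: "continuous_on S g'"
    using assms(3) by (rule C1_onE) blast
  have "(f has_derivative blinfun_apply (g' x)) (at x)" if "x \<in> S" for x
    using has_derivative_transform_within_open[OF d[OF that] assms(1) that] assms(2) by metis
  then show ?thesis using c by (rule C1_onI_blinfun)
qed

text \<open>Derivatives at a point are unique, so all local pieces share the derivative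
  \<open>frechet_derivative f\<close> and glue.\<close>

lemma C1_on_localI:
  fixes f :: "'a::euclidean_space \<Rightarrow> 'b::real_normed_vector"
  assumes "\<And>x. x \<in> S \<Longrightarrow> \<exists>U. open U \<and> x \<in> U \<and> C1_on f U"
  shows "C1_on f S"
proof (rule C1_onI)
  fix x assume "x \<in> S"
  then obtain U where U: "open U" "x \<in> U" "C1_on f U" using assms by blast
  then show "(f has_derivative frechet_derivative f (at x)) (at x)"
    by (elim C1_onE) (auto simp: differentiable_def simp flip: frechet_derivative_works)
next
  fix i :: 'a
  have "isCont (\<lambda>x. frechet_derivative f (at x) i) x" if x: "x \<in> S" for x
  proof -
    obtain U where U: "open U" "x \<in> U" "C1_on f U" using assms x by blast
    then have "Ck_on (Suc 0) f U" using C1_on_iff_Ck_on_1 by fastforce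
    then have "continuous_on U (\<lambda>x. frechet_derivative f (at x) i)"
      using Ck_on_SucD(2) by fastforce
    then show ?thesis using U by (simp add: continuous_on_eq_continuous_at)
  qed
  then show "continuous_on S (\<lambda>x. frechet_derivative f (at x) i)"
    by (simp add: continuous_at_imp_continuous_on)
qed

lemma C1_on_imp_continuous_on: "C1_on f S \<Longrightarrow> continuous_on S f"
  by (elim C1_onE, intro continuous_at_imp_continuous_on ballI has_derivative_continuous)

lemma C1_on_compose:
  assumes "C1_on g T" "C1_on f S" "f ` S \<subseteq> T"
  shows "C1_on (\<lambda>x. g (f x)) S"
proof -
  obtain f' where f: "\<And>x. x \<in> S \<Longrightarrow> (f has_derivative blinfun_apply (f' x)) (at x)"
    and cf: "continuous_on S f'"
    using assms(2) by (rule C1_onE) blast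
  obtain g' where g: "\<And>x. x \<in> T \<Longrightarrow> (g has_derivative blinfun_apply (g' x)) (at x)"
    and cg: "continuous_on T g'"
    using assms(1) by (rule C1_onE) blast
  show ?thesis
  proof (rule C1_onI_blinfun)
    show "((\<lambda>x. g (f x)) has_derivative blinfun_apply (g' (f x) o\<^sub>L f' x)) (at x)" if "x \<in> S" for x
      using has_derivative_compose[OF f[OF that] g[of "f x"]] that assms(3)
      by (auto simp: blinfun_compose.rep_eq o_def)
    show "continuous_on S (\<lambda>x. g' (f x) o\<^sub>L f' x)"
      using assms cf continuous_on_compose2[OF cg C1_on_imp_continuous_on[OF assms(2)]]
      by (intro bounded_bilinear.continuous_on[OF bounded_bilinear_blinfun_compose]) auto
  qed
qed

lemma C1_on_bounded_linear: "bounded_linear f \<Longrightarrow> C1_on f S"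
  by (rule C1_onI_blinfun[where f'="\<lambda>x. Blinfun f"])
    (auto simp: bounded_linear_Blinfun_apply bounded_linear_imp_has_derivative)

lemma C1_on_const: "C1_on (\<lambda>x. c) S"
  by (rule C1_onI_blinfun[where f'="\<lambda>x. 0"]) (auto simp: zero_blinfun.rep_eq)

lemma C1_on_ident: "C1_on (\<lambda>x. x) S"
  by (rule C1_on_bounded_linear) (rule bounded_linear_ident)

lemma C1_on_compose_bounded_linear:
  "bounded_linear L \<Longrightarrow> C1_on f S \<Longrightarrow> C1_on (\<lambda>x. L (f x)) S"
  by (rule C1_on_compose[OF C1_on_bounded_linear[of L UNIV]]) auto

lemma C1_on_fst: "C1_on f S \<Longrightarrow> C1_on (\<lambda>x. fst (f x)) S"
  by (rule C1_on_compose_bounded_linear[OF bounded_linear_fst])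

lemma C1_on_snd: "C1_on f S \<Longrightarrow> C1_on (\<lambda>x. snd (f x)) S"
  by (rule C1_on_compose_bounded_linear[OF bounded_linear_snd])

lemma C1_on_Pair:
  assumes "C1_on f S" "C1_on g S"
  shows "C1_on (\<lambda>x. (f x, g x)) S"
proof -
  obtain f' where f: "\<And>x. x \<in> S \<Longrightarrow> (f has_derivative blinfun_apply (f' x)) (at x)"
    and cf: "continuous_on S f'"
    using assms(1) by (rule C1_onE) blast
  obtain g' where g: "\<And>x. x \<in> S \<Longrightarrow> (g has_derivative blinfun_apply (g' x)) (at x)"
    and cg: "continuous_on S g'"
    using assms(2) by (rule C1_onE) blast
  define A :: "'b \<Rightarrow>\<^sub>L ('b \<times> 'c)" where "A = Blinfun (\<lambda>x. (x, 0))"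
  define B :: "'c \<Rightarrow>\<^sub>L ('b \<times> 'c)" where "B = Blinfun (\<lambda>x. (0, x))"
  have A: "A x = (x, 0)" for x
    unfolding A_def by (subst bounded_linear_Blinfun_apply)
      (auto intro: bounded_linear_Pair bounded_linear_ident bounded_linear_zero)
  have B: "B x = (0, x)" for x
    unfolding B_def by (subst bounded_linear_Blinfun_apply)
      (auto intro: bounded_linear_Pair bounded_linear_ident bounded_linear_zero)
  show ?thesis
  proof (rule C1_onI_blinfun)
    show "((\<lambda>x. (f x, g x)) has_derivative blinfun_apply ((A o\<^sub>L f' x) + (B o\<^sub>L g' x))) (at x)"
      if "x \<in> S" for x
      by (rule has_derivative_eq_rhs[OF has_derivative_Pair[OF f[OF that] g[OF that]]])
        (simp add: fun_eq_iff blinfun.add_left A B)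
    show "continuous_on S (\<lambda>x. (A o\<^sub>L f' x) + (B o\<^sub>L g' x))"
      by (intro continuous_on_add bounded_bilinear.continuous_on[OF bounded_bilinear_blinfun_compose]
          cf cg continuous_on_const)
  qed
qed

lemma C1_on_add: "C1_on f S \<Longrightarrow> C1_on g S \<Longrightarrow> C1_on (\<lambda>x. f x + g x) S"
  using C1_on_compose_bounded_linear[OF bounded_linear_add[OF bounded_linear_fst bounded_linear_snd]
    C1_on_Pair, of f S g] by simp

lemma C1_on_diff: "C1_on f S \<Longrightarrow> C1_on g S \<Longrightarrow> C1_on (\<lambda>x. f x - g x) S"
  using C1_on_compose_bounded_linear[OF bounded_linear_sub[OF bounded_linear_fst bounded_linear_snd]
    C1_on_Pair, of f S g] by simp

lemma C1_on_bilinear: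
  fixes f :: "'a::euclidean_space \<Rightarrow> 'b::real_normed_vector"
  assumes bl: "bounded_bilinear b" and "C1_on f S" "C1_on g S"
  shows "C1_on (\<lambda>x. b (f x) (g x)) S"
proof -
  interpret bounded_bilinear b by fact
  obtain f' where f: "\<And>x. x \<in> S \<Longrightarrow> (f has_derivative blinfun_apply (f' x)) (at x)"
    and cf: "continuous_on S f'"
    using assms(2) by (rule C1_onE) blast
  obtain g' where g: "\<And>x. x \<in> S \<Longrightarrow> (g has_derivative blinfun_apply (g' x)) (at x)"
    and cg: "continuous_on S g'"
    using assms(3) by (rule C1_onE) blast
  note c = C1_on_imp_continuous_on[OF assms(2)] C1_on_imp_continuous_on[OF assms(3)]
  show ?thesis
    by (rule C1_onI[OF FDERIV[OF f g]]) (auto intro!: continuous_intros c cf cg continuous_on)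
qed

lemmas C1_on_scaleR = C1_on_bilinear[OF bounded_bilinear_scaleR]
lemmas C1_on_mult = C1_on_bilinear[OF bounded_bilinear_mult]
lemmas C1_on_inner = C1_on_bilinear[OF bounded_bilinear_inner]

lemma C1_on_real_fun:
  fixes f :: "real \<Rightarrow> real"
  assumes "\<And>x. x \<in> S \<Longrightarrow> (f has_real_derivative f' x) (at x)" "continuous_on S f'"
  shows "C1_on f S"
  by (rule C1_onI[where D="\<lambda>x h. f' x * h"])
    (use assms in \<open>auto simp: has_field_derivative_def intro!: continuous_intros\<close>)

lemma C1_on_sinh: "C1_on f S \<Longrightarrow> C1_on (\<lambda>x. sinh (f x :: real)) S"
  by (rule C1_on_compose[OF C1_on_real_fun[where f=sinh and f'=cosh and S=UNIV]])
    (auto intro!: derivative_eq_intros continuous_intros)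

lemma C1_on_cosh: "C1_on f S \<Longrightarrow> C1_on (\<lambda>x. cosh (f x :: real)) S"
  by (rule C1_on_compose[OF C1_on_real_fun[where f=cosh and f'=sinh and S=UNIV]])
    (auto intro!: derivative_eq_intros continuous_intros)

lemma C1_on_sqrt:
  assumes "C1_on f S" "\<And>x. x \<in> S \<Longrightarrow> f x > 0"
  shows "C1_on (\<lambda>x. sqrt (f x)) S"
  by (rule C1_on_compose[OF C1_on_real_fun[where f=sqrt and f'="\<lambda>x. inverse (sqrt x) / 2"
        and S="{0<..}"] assms(1)])
    (use assms(2) in \<open>auto intro!: DERIV_real_sqrt continuous_intros\<close>)

lemma C1_on_inverse:
  fixes f :: "'a::real_normed_vector \<Rightarrow> real"
  assumes "C1_on f S" "\<And>x. x \<in> S \<Longrightarrow> f x \<noteq> 0"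
  shows "C1_on (\<lambda>x. inverse (f x)) S"
  by (rule C1_on_compose[OF C1_on_real_fun[where f=inverse and f'="\<lambda>x. - (inverse x ^ 2)"
        and S="- {0}"] assms(1)])
    (use assms(2) in \<open>auto intro!: derivative_eq_intros continuous_intros simp: power2_eq_square\<close>)

lemma C1_on_norm:
  fixes f :: "'a::euclidean_space \<Rightarrow> 'b::real_inner"
  assumes "C1_on f S" "\<And>x. x \<in> S \<Longrightarrow> f x \<noteq> 0"
  shows "C1_on (\<lambda>x. norm (f x)) S"
  unfolding norm_eq_sqrt_inner
  by (intro C1_on_sqrt C1_on_inner) (use assms in auto)

section \<open>Parameter integrals and inverse functions in the C^1 class\<close>

lemma C1_on_integral:
  fixes f :: "'a::euclidean_space \<Rightarrow> real \<Rightarrow> 'b::banach"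
  assumes S: "open S" and "C1_on (\<lambda>z. f (fst z) (snd z)) (S \<times> UNIV)"
  shows "C1_on (\<lambda>x. integral {0..1} (f x)) S"
proof -
  obtain f' where d: "\<And>z. z \<in> S \<times> UNIV \<Longrightarrow>
      ((\<lambda>z. f (fst z) (snd z)) has_derivative blinfun_apply (f' z)) (at z)"
    and c: "continuous_on (S \<times> UNIV) f'"
    using assms(2) by (rule C1_onE) blast
  \<comment> \<open>Precomposition with \<open>J\<close> extracts from the total derivative the
    partial derivative in the parameter \<open>x\<close>.\<close>
  define J :: "'a \<Rightarrow>\<^sub>L ('a \<times> real)" where "J = Blinfun (\<lambda>x. (x, 0))"
  have J: "J x = (x, 0)" for x
    unfolding J_def by (subst bounded_linear_Blinfun_apply)
      (auto intro: bounded_linear_Pair bounded_linear_ident bounded_linear_zero)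
  define fx where "fx x t = f' (x, t) o\<^sub>L J" for x t
  have dx: "((\<lambda>x. f x t) has_derivative blinfun_apply (fx x t)) (at x)" if "x \<in> S" for x t
  proof -
    have "((\<lambda>x. (x, t)) has_derivative J) (at x)"
      by (auto intro!: derivative_eq_intros simp: J fun_eq_iff)
    from has_derivative_compose[OF this d[of "(x, t)"]] show ?thesis
      using that by (simp add: fx_def blinfun_compose.rep_eq o_def)
  qed
  have cfx: "continuous_on (S \<times> cbox 0 1) (\<lambda>(x, t). fx x t)"
    unfolding fx_def case_prod_unfold
    by (intro bounded_bilinear.continuous_on[OF bounded_bilinear_blinfun_compose]
        continuous_on_compose2[OF c] continuous_intros) auto
  have cf: "continuous_on {0..1} (f x)" if "x \<in> S" for x
    using continuous_on_compose2[OF C1_on_imp_continuous_on[OF assms(2)]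
        continuous_on_Pair[OF continuous_on_const continuous_on_id], of x "{0..1}"] that by auto
  show ?thesis
  proof (rule C1_onI_blinfun)
    fix x assume x: "x \<in> S"
    then obtain e where e: "e > 0" "ball x e \<subseteq> S" using S open_contains_ball by blast
    have "((\<lambda>x. integral (cbox 0 1) (f x)) has_derivative integral (cbox 0 1) (fx x))
        (at x within ball x e)"
      using e cf
      by (intro leibniz_rule has_derivative_at_withinI[OF dx] continuous_on_subset[OF cfx]
          integrable_continuous) auto
    then show "((\<lambda>x. integral {0..1} (f x)) has_derivative integral {0..1} (fx x)) (at x)"
      using e by (simp add: at_within_open[of x "ball x e"])
  next
    show "continuous_on S (\<lambda>x. integral {0..1} (fx x))"
      using integral_continuous_on_param[OF cfx] by simp
  qed
qed

text \<open>By substitution this is the integral of \<open>f\<close> from 0 to \<open>s\<close>. The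
  fixed domain \<open>{0..1}\<close> treats both signs of \<open>s\<close> alike and leaves every
  parameter in the integrand, where \<open>C1_on_integral\<close> can differentiate it.\<close>

lemma has_vector_derivative_scaled_integral:
  fixes f :: "real \<Rightarrow> 'a::banach"
  assumes f: "continuous_on UNIV f"
  shows "((\<lambda>s. s *\<^sub>R integral {0..1} (\<lambda>t. f (t * s))) has_vector_derivative f s) (at s)"
proof -
  \<comment> \<open>The antiderivative is taken on a compact interval; adding 1 makes
    \<open>s\<close> an interior point of it.\<close>
  define R where "R = \<bar>s\<bar> + 1"
  obtain F where F: "\<And>x. x \<in> {-R..R} \<Longrightarrow> (F has_vector_derivative f x) (at x within {-R..R})"
    using antiderivative_continuous[OF continuous_on_subset[OF f]] by blast
  have eq: "u *\<^sub>R integral {0..1} (\<lambda>t. f (t * u)) = F u - F 0" if u: "u \<in> {-R<..<R}" for u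
  proof -
    have im: "(\<lambda>t. t * u) ` {0..1} \<subseteq> {-R..R}"
    proof safe
      fix t :: real assume t: "t \<in> {0..1}"
      have "\<bar>t * u\<bar> \<le> 1 * \<bar>u\<bar>" unfolding abs_mult using t by (intro mult_right_mono) auto
      then show "t * u \<in> {-R..R}" using u by auto
    qed
    have "((\<lambda>t. F (t * u)) has_vector_derivative u *\<^sub>R f (t * u)) (at t within {0..1})"
      if "t \<in> {0..1}" for t
    proof -
      have "((\<lambda>t. t * u) has_vector_derivative u) (at t within {0..1})"
        by (auto intro!: derivative_eq_intros)
      moreover have "(F has_vector_derivative f (t * u)) (at (t * u) within (\<lambda>t. t * u) ` {0..1})"
        using F[of "t * u"] im that has_vector_derivative_within_subset by blast
      ultimately show ?thesis
        using vector_diff_chain_within by (fastforce simp: o_def)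
    qed
    then have "((\<lambda>t. u *\<^sub>R f (t * u)) has_integral F (1 * u) - F (0 * u)) {0..1}"
      by (intro fundamental_theorem_of_calculus) auto
    then show ?thesis by (simp add: has_integral_iff)
  qed
  have s: "s \<in> {-R<..<R}" by (auto simp: R_def)
  then have "(F has_vector_derivative f s) (at s)"
    using F[of s] by (simp add: at_within_Icc_at)
  then have "((\<lambda>u. F u - F 0) has_vector_derivative f s) (at s)"
    by (auto intro!: derivative_eq_intros)
  then show ?thesis
    by (rule has_vector_derivative_transform_within_open[OF _ _ s]) (auto simp: eq)
qed

text \<open>Resolvent identity: \<open>B y - B y0\<close> is the composition of \<open>B y\<close>,
  \<open>A y0 - A y\<close> and \<open>B y0\<close>. It first bounds \<open>norm (B y)\<close> by
  \<open>2 * norm (B y0)\<close> near \<open>y0\<close> and then gives the convergence.\<close>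

lemma blinfun_inverse_continuous_on:
  fixes A :: "'t::t2_space \<Rightarrow> 'a::real_normed_vector \<Rightarrow>\<^sub>L 'b::real_normed_vector"
    and B :: "'t \<Rightarrow> 'b \<Rightarrow>\<^sub>L 'a"
  assumes A: "continuous_on V A"
    and BA: "\<And>y x. y \<in> V \<Longrightarrow> blinfun_apply (B y) (blinfun_apply (A y) x) = x"
    and AB: "\<And>y x. y \<in> V \<Longrightarrow> blinfun_apply (A y) (blinfun_apply (B y) x) = x"
  shows "continuous_on V B"
  unfolding continuous_on_def
proof
  fix y0 assume y0: "y0 \<in> V"
  define b where "b = norm (B y0)"
  define d where "d y = norm (A y0 - A y)" for y
  have "((\<lambda>y. A y0 - A y) \<longlongrightarrow> A y0 - A y0) (at y0 within V)"
    using A y0 by (intro tendsto_intros) (auto simp: continuous_on_def)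
  then have d: "(d \<longlongrightarrow> 0) (at y0 within V)"
    unfolding d_def by (simp add: tendsto_norm_zero)
  have le: "norm (B y - B y0) \<le> norm (B y) * d y * b" if "y \<in> V" for y
  proof -
    have "B y - B y0 = B y o\<^sub>L (A y0 - A y) o\<^sub>L B y0"
      using BA[OF that] AB[OF y0]
      by (intro blinfun_eqI) (simp add: blinfun.diff_left blinfun.diff_right)
    also have "norm \<dots> \<le> norm (B y o\<^sub>L (A y0 - A y)) * norm (B y0)"
      by (rule norm_blinfun_compose)
    also have "\<dots> \<le> norm (B y) * norm (A y0 - A y) * norm (B y0)"
      by (intro mult_right_mono norm_blinfun_compose) auto
    finally show ?thesis by (simp add: b_def d_def)
  qed
  have b: "b \<ge> 0" by (simp add: b_def)
  \<comment> \<open>This makes \<open>d y * b\<close> at most 1/2, so that the term with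
    \<open>norm (B y)\<close> can be absorbed; \<open>b + 1\<close> avoids dividing by zero.\<close>
  have "\<forall>\<^sub>F y in at y0 within V. d y < 1 / (2 * (b + 1))"
    using order_tendstoD(2)[OF d] b by (simp add: add_nonneg_pos)
  then have "\<forall>\<^sub>F y in at y0 within V. norm (B y - B y0) \<le> 2 * b * b * d y"
  proof (rule eventually_elim2)
    show "\<forall>\<^sub>F y in at y0 within V. y \<in> V" by (simp add: eventually_at_filter)
  next
    fix y assume s: "d y < 1 / (2 * (b + 1))" and "y \<in> V"
    have d0: "d y \<ge> 0" by (simp add: d_def)
    have "d y * b \<le> d y * (b + 1)" using d0 by (intro mult_left_mono) auto
    also have "\<dots> \<le> 1 / 2" using s b by (simp add: field_simps)
    finally have db: "d y * b \<le> 1 / 2" .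
    have "norm (B y) \<le> b + norm (B y - B y0)"
      unfolding b_def using norm_triangle_ineq[of "B y0" "B y - B y0"] by simp
    also have "\<dots> \<le> b + norm (B y) * (d y * b)"
      using le[OF \<open>y \<in> V\<close>] by (simp add: mult.assoc)
    also have "\<dots> \<le> b + norm (B y) * (1 / 2)"
      using db by (intro add_left_mono mult_left_mono) auto
    finally have "norm (B y) \<le> 2 * b" by simp
    then have "norm (B y) * (d y * b) \<le> 2 * b * (d y * b)"
      using d0 b by (intro mult_right_mono) auto
    then show "norm (B y - B y0) \<le> 2 * b * b * d y"
      using le[OF \<open>y \<in> V\<close>] by (simp add: mult_ac)
  qed
  then have "((\<lambda>y. B y - B y0) \<longlongrightarrow> 0) (at y0 within V)"
    by (rule Lim_null_comparison) (use tendsto_mult_right_zero[OF d] in simp)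
  then show "(B \<longlongrightarrow> B y0) (at y0 within V)" by (simp add: LIM_zero_iff)
qed

text \<open>An injective endomorphism of a finite-dimensional space is invertible, so the inverse
  function theorem applies. It gives the derivative of \<open>g\<close> at \<open>y\<close> as the
  inverse of \<open>f' (g y)\<close>; that this depends continuously on \<open>y\<close> is
  \<open>blinfun_inverse_continuous_on\<close>.\<close>

lemma C1_local_inverse:
  fixes f :: "'a::euclidean_space \<Rightarrow> 'a"
  assumes S: "open S" "x0 \<in> S" and f: "C1_on f S"
    and D: "(f has_derivative D) (at x0)" and inj: "\<And>h. D h = 0 \<Longrightarrow> h = 0"
  obtains U V g where "open U" "x0 \<in> U" "U \<subseteq> S" "open V" "f ` U = V"
    "\<And>y. y \<in> U \<Longrightarrow> g (f y) = y" "C1_on g V"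
proof -
  obtain f' where d: "\<And>x. x \<in> S \<Longrightarrow> (f has_derivative blinfun_apply (f' x)) (at x)"
    and c: "continuous_on S f'"
    using f by (rule C1_onE) blast
  have D_eq: "D = blinfun_apply (f' x0)"
    using has_derivative_unique[OF D d] S by blast
  have linD: "linear D" using D by (rule has_derivative_linear)
  have "inj D"
    using inj by (simp add: linear_injective_0[OF linD])
  then obtain L where L: "linear L" "L \<circ> D = id"
    using linear_injective_left_inverse[OF linD] by blast
  have "Blinfun L o\<^sub>L f' x0 = id_blinfun"
    using L D_eq by (intro blinfun_eqI)
      (simp add: bounded_linear_Blinfun_apply linear_conv_bounded_linear fun_eq_iff)
  from inverse_function_theorem[OF S(1) d c S(2) this]
  obtain U V g g' where U: "open U" "U \<subseteq> S" "x0 \<in> U" "open V" "homeomorphism U V f g"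
    and g: "\<And>y. y \<in> V \<Longrightarrow> (g has_derivative g' y) (at y)"
    and g': "\<And>y. y \<in> V \<Longrightarrow> g' y = inv (blinfun_apply (f' (g y)))"
    and bij: "\<And>y. y \<in> V \<Longrightarrow> bij (blinfun_apply (f' (g y)))"
    by metis
  have B: "blinfun_apply (Blinfun (g' y)) = g' y" if "y \<in> V" for y
    using has_derivative_bounded_linear[OF g[OF that]] by (rule bounded_linear_Blinfun_apply)
  have gV: "g y \<in> S" if "y \<in> V" for y
    using U that by (auto simp: homeomorphism_def)
  have "continuous_on V (\<lambda>y. f' (g y))"
    using U gV by (intro continuous_on_compose2[OF c]) (auto simp: homeomorphism_def)
  then have "continuous_on V (\<lambda>y. Blinfun (g' y))"
    by (rule blinfun_inverse_continuous_on; simp only: B)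
      (simp_all add: g' bij bij_is_inj bij_is_surj surj_f_inv_f)
  then have "C1_on g V"
    using g B by (intro C1_onI_blinfun[where f'="\<lambda>y. Blinfun (g' y)"]) auto
  moreover have "f ` U = V" "\<And>y. y \<in> U \<Longrightarrow> g (f y) = y"
    using U by (auto simp: homeomorphism_def)
  ultimately show thesis using that U by blast
qed

section \<open>Regularity at the origin by polar coordinates\<close>

lemma tendsto_polar:
  fixes K :: "real \<times> 'a::euclidean_space \<Rightarrow> 'b::metric_space"
  assumes K: "continuous_on (UNIV \<times> - {0}) K" and K0: "\<And>w. norm w = 1 \<Longrightarrow> K (0, w) = k"
  shows "((\<lambda>u. K (norm u, u /\<^sub>R norm u)) \<longlongrightarrow> k) (at 0)"
proof (rule tendstoI)
  fix e :: real assume e: "e > 0"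
  \<comment> \<open>Compactness of the unit sphere makes the limit at radius 0 uniform in the
    direction.\<close>
  have "uniformly_continuous_on ({0..1} \<times> sphere 0 1) K"
    by (intro compact_uniformly_continuous continuous_on_subset[OF K] compact_Times) auto
  then obtain d where d: "d > 0"
    "\<And>z z'. z \<in> {0..1} \<times> sphere 0 1 \<Longrightarrow> z' \<in> {0..1} \<times> sphere 0 1 \<Longrightarrow> dist z' z < d \<Longrightarrow>
      dist (K z') (K z) < e"
    using e unfolding uniformly_continuous_on_def by blast
  have "dist (K (norm u, u /\<^sub>R norm u)) k < e" if "u \<noteq> 0" "dist u 0 < min d 1" for u
  proof -
    have "dist (K (norm u, u /\<^sub>R norm u)) (K (0, u /\<^sub>R norm u)) < e"
      using that by (intro d(2)) (auto simp: dist_Pair_Pair)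
    then show ?thesis using that by (simp add: K0)
  qed
  then show "\<forall>\<^sub>F u in at 0. dist (K (norm u, u /\<^sub>R norm u)) k < e"
    unfolding eventually_at using d(1) by (intro exI[of _ "min d 1"]) auto
qed

text \<open>In polar coordinates \<open>u = rw\<close> the derivative of \<open>u \<mapsto> r M(r, w)\<close> off the origin is
  \<open>h \<mapsto> \<langle>w, h\<rangle> M(r, w) + DM(r, w)(r \<langle>w, h\<rangle>, h - \<langle>w, h\<rangle> w)\<close>,
  which is continuous up to \<open>r = 0\<close>, where it is the identity.\<close>

lemma C1_polar:
  fixes M :: "real \<times> 'a::euclidean_space \<Rightarrow> 'a"
  assumes M: "C1_on M (UNIV \<times> - {0})" and M0: "\<And>w. w \<noteq> 0 \<Longrightarrow> M (0, w) = w"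
  defines "F \<equiv> \<lambda>u. norm u *\<^sub>R M (norm u, u /\<^sub>R norm u)"
  shows "C1_on F UNIV" and "(F has_derivative (\<lambda>h. h)) (at 0)"
proof -
  obtain M' where d: "\<And>z. z \<in> UNIV \<times> - {0} \<Longrightarrow> (M has_derivative blinfun_apply (M' z)) (at z)"
    and c: "continuous_on (UNIV \<times> - {0}) M'"
    using M by (rule C1_onE) blast
  have cM: "continuous_on (UNIV \<times> - {0}) M" using M by (rule C1_on_imp_continuous_on)
  define K where "K z h = (snd z \<bullet> h) *\<^sub>R M z
      + M' z (fst z * (snd z \<bullet> h), h - (snd z \<bullet> h) *\<^sub>R snd z)" for z h
  define D where "D u = (if u = 0 then (\<lambda>h. h) else K (norm u, u /\<^sub>R norm u))" for u
  have cK: "continuous_on (UNIV \<times> - {0}) (\<lambda>z. K z h)" for h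
    unfolding K_def by (intro continuous_intros c cM)
  \<comment> \<open>At radius 0 the hypothesis \<open>M0\<close> determines only the derivative of
    \<open>M\<close> in the direction variable. The radial one carries the factor
    \<open>fst z\<close> in \<open>K\<close> and drops out there.\<close>
  have M'0: "M' (0, w) (0, k) = k" if "w \<noteq> 0" for w k
  proof -
    have "((\<lambda>w. (0::real, w)) has_derivative (\<lambda>k. (0, k))) (at w)"
      by (auto intro!: derivative_eq_intros)
    from has_derivative_compose[OF this d[of "(0, w)"]]
    have "((\<lambda>w. M (0, w)) has_derivative (\<lambda>k. M' (0, w) (0, k))) (at w)"
      using that by simp
    then have "((\<lambda>w. w) has_derivative (\<lambda>k. M' (0, w) (0, k))) (at w)"
      by (rule has_derivative_transform_within_open[of _ _ _ _ "- {0}"]) (auto simp: that M0)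
    from has_derivative_unique[OF this has_derivative_ident] show ?thesis
      by (simp add: fun_eq_iff)
  qed
  have K0: "K (0, w) h = h" if "norm w = 1" for w h
  proof -
    have "w \<noteq> 0" using that by auto
    then show ?thesis by (simp add: K_def M0 M'0)
  qed
  have D0: "(F has_derivative D 0) (at 0)"
  proof -
    \<comment> \<open>The remainder \<open>F u - u\<close> is \<open>norm u\<close> times this
      difference, so differentiability at 0 only asks for continuity of \<open>M\<close> up to
      radius 0.\<close>
    have "((\<lambda>u. M (norm u, u /\<^sub>R norm u) - u /\<^sub>R norm u) \<longlongrightarrow> 0) (at 0)"
    proof -
      have "continuous_on (UNIV \<times> - {0}) (\<lambda>z. M z - snd z)"
        by (intro continuous_intros cM)
      moreover have "M (0, w) - snd (0::real, w) = 0" if "norm w = 1" for w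
        using that M0[of w] by (cases "w = 0") auto
      ultimately show ?thesis using tendsto_polar[of "\<lambda>z. M z - snd z" 0] by simp
    qed
    then have *: "((\<lambda>u. norm (M (norm u, u /\<^sub>R norm u) - u /\<^sub>R norm u)) \<longlongrightarrow> 0) (at 0)"
      by (rule tendsto_norm_zero)
    have eq: "norm (M (norm u, u /\<^sub>R norm u) - u /\<^sub>R norm u) = norm (F u - u) / norm u"
      if "u \<noteq> 0" for u
    proof -
      have "F u - u = norm u *\<^sub>R (M (norm u, u /\<^sub>R norm u) - u /\<^sub>R norm u)"
        using that by (simp add: F_def scaleR_right_diff_distrib)
      then show ?thesis using that by simp
    qed
    have "((\<lambda>u. norm (F u - u) / norm u) \<longlongrightarrow> 0) (at 0)"
      by (rule Lim_transform_eventually[OF *])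
        (auto simp: eventually_at eq intro!: exI[of _ 1])
    moreover have "F 0 = 0" by (simp add: F_def)
    ultimately show ?thesis
      by (simp add: has_derivative_iff_norm D_def bounded_linear_ident)
  qed
  have Du: "(F has_derivative D u) (at u)" if "u \<noteq> 0" for u
  proof -
    define r where "r = norm u"
    define w where "w = u /\<^sub>R r"
    have r: "r > 0" and w: "w \<noteq> 0" and u: "u = r *\<^sub>R w" and nw: "norm w = 1"
      using that by (auto simp: r_def w_def)
    have dn: "(norm has_derivative (\<lambda>h. w \<bullet> h)) (at u)"
      using has_derivative_norm[OF that] by (simp add: sgn_div_norm w_def r_def inner_commute)
    have dw: "((\<lambda>u. u /\<^sub>R norm u) has_derivative (\<lambda>h. (h - (w \<bullet> h) *\<^sub>R w) /\<^sub>R r)) (at u)"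
      by (rule has_derivative_eq_rhs[OF has_derivative_scaleR[OF
            Deriv.has_derivative_inverse[OF _ dn] has_derivative_ident]])
        (use r that in \<open>auto simp: fun_eq_iff u nw algebra_simps\<close>)
    have "(M has_derivative M' (r, w)) (at (norm u, u /\<^sub>R norm u))"
      using d[of "(r, w)"] w by (simp add: r_def w_def)
    from has_derivative_compose[OF has_derivative_Pair[OF dn dw] this]
    have dM: "((\<lambda>u. M (norm u, u /\<^sub>R norm u)) has_derivative
        (\<lambda>h. M' (r, w) (w \<bullet> h, (h - (w \<bullet> h) *\<^sub>R w) /\<^sub>R r))) (at u)"
      by simp
    \<comment> \<open>The factor \<open>r\<close> in front of \<open>M\<close> cancels the
      \<open>1 / r\<close> from the derivative of \<open>u / norm u\<close>; this is why
      \<open>K\<close> has no singularity at radius 0.\<close>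
    have sc: "r *\<^sub>R M' (r, w) (w \<bullet> h, (h - (w \<bullet> h) *\<^sub>R w) /\<^sub>R r)
        = M' (r, w) (r * (w \<bullet> h), h - (w \<bullet> h) *\<^sub>R w)" for h
      using r by (simp flip: blinfun.scaleR_right)
    show ?thesis
      unfolding F_def
      by (rule has_derivative_eq_rhs[OF has_derivative_scaleR[OF dn dM]])
        (use that in \<open>simp add: D_def K_def fun_eq_iff sc flip: r_def w_def\<close>)
  qed
  show "C1_on F UNIV"
  proof (rule C1_onI)
    show "(F has_derivative D u) (at u)" for u
      using D0 Du by (cases "u = 0") auto
    fix i :: 'a
    have "isCont (\<lambda>u. D u i) u" for u
    proof (cases "u = 0")
      case True
      have "((\<lambda>u. D u i) \<longlongrightarrow> i) (at 0)"
        by (rule Lim_transform_eventually[OF tendsto_polar[OF cK K0]])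
          (auto simp: eventually_at D_def intro!: exI[of _ 1])
      then show ?thesis using True by (simp add: isCont_def D_def)
    next
      case False
      have "continuous_on (- {0}) (\<lambda>u. K (norm u, u /\<^sub>R norm u) i)"
        by (intro continuous_on_compose2[OF cK] continuous_intros) auto
      then have "continuous_on (- {0}) (\<lambda>u. D u i)"
        by (rule continuous_on_eq) (simp add: D_def)
      then show ?thesis using False by (simp add: continuous_on_eq_continuous_at open_Compl)
    qed
    then show "continuous_on UNIV (\<lambda>u. D u i)"
      by (simp add: continuous_at_imp_continuous_on)
  qed
  show "(F has_derivative (\<lambda>h. h)) (at 0)" using D0 by (simp add: D_def)
qed

section \<open>Local diffeomorphisms into the torus\<close>

lemma lattice_rel_small_imp_eq:
  assumes "lattice_rel p q" "dist p q < 1"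
  shows "p = q"
proof -
  have "p $ i = q $ i" for i
  proof -
    have "\<bar>p $ i - q $ i\<bar> < 1"
      using component_le_norm_cart[of "p - q" i] assms(2) by (simp add: dist_norm)
    moreover obtain n :: int where "p $ i - q $ i = of_int n"
      using assms(1) by (auto simp: lattice_rel_def elim: Ints_cases)
    ultimately show ?thesis by (simp flip: of_int_abs)
  qed
  then show ?thesis by (simp add: vec_eq_iff)
qed

lemma torus_proj_eq_iff: "torus_proj p = torus_proj q \<longleftrightarrow> lattice_rel p q"
  by (rule torus.abs_eq_iff)

lemma torus_proj_rep: "torus_proj (torus_rep x) = x"
  by (rule Quotient3_abs_rep[OF Quotient3_torus])

lemma torus_proj_add_lattice:
  "(\<And>i. k $ i \<in> \<int>) \<Longrightarrow> torus_proj (p + k) = torus_proj p"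
  by (simp add: torus_proj_eq_iff lattice_rel_def)

text \<open>The full preimage of the image is the union of the lattice translates of
  \<open>S\<close>.\<close>

lemma open_torus_proj_image:
  assumes "open S"
  shows "open (torus_proj ` S)"
proof -
  have "torus_proj -` torus_proj ` S = (\<Union>k\<in>{k. \<forall>i. k $ i \<in> \<int>}. (+) k ` S)"
  proof (intro set_eqI iffI)
    fix p assume "p \<in> torus_proj -` torus_proj ` S"
    then obtain q where "torus_proj p = torus_proj q" "q \<in> S" by blast
    then show "p \<in> (\<Union>k\<in>{k. \<forall>i. k $ i \<in> \<int>}. (+) k ` S)"
      by (intro UN_I[of "p - q"] image_eqI[of _ _ q]) (auto simp: torus_proj_eq_iff lattice_rel_def)
  next
    fix p assume "p \<in> (\<Union>k\<in>{k. \<forall>i. k $ i \<in> \<int>}. (+) k ` S)"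
    then obtain k q where "\<forall>i. k $ i \<in> \<int>" "q \<in> S" "p = q + k"
      by (auto simp: add.commute)
    then show "p \<in> torus_proj -` torus_proj ` S"
      using torus_proj_add_lattice[of k q] by auto
  qed
  then show ?thesis
    unfolding open_torus_def using assms by (auto intro!: open_UN open_translation)
qed

text \<open>Near \<open>H u\<close> the map \<open>f\<close> is
  \<open>torus_proj \<circ> E \<circ> a\<close> with \<open>a\<close> a local inverse of
  \<open>H\<close>, a composition of local diffeomorphisms. In the application \<open>H\<close> and
  \<open>E\<close> have formulas whereas the inverse of \<open>H\<close> has none.\<close>

lemma local_diffeoI:
  fixes f :: "real^2 \<Rightarrow> torus" and H E :: "real^2 \<Rightarrow> real^2"
  assumes H: "C1_on H UNIV" "\<And>u D h. (H has_derivative D) (at u) \<Longrightarrow> D h = 0 \<Longrightarrow> h = 0"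
    and E: "C1_on E UNIV" "\<And>u D h. (E has_derivative D) (at u) \<Longrightarrow> D h = 0 \<Longrightarrow> h = 0"
    and surj: "surj H" and f: "\<And>u. f (H u) = torus_proj (E u)"
  shows "local_diffeo f"
  unfolding local_diffeo_def
proof
  fix w
  obtain u where u: "w = H u" using surj by blast
  obtain DH where DH: "(H has_derivative DH) (at u)" using C1_onE[OF H(1)] by blast
  obtain DE where DE: "(E has_derivative DE) (at u)" using C1_onE[OF E(1)] by blast
  obtain U1 V1 a where 1: "open U1" "u \<in> U1" "open V1" "H ` U1 = V1"
    "\<And>y. y \<in> U1 \<Longrightarrow> a (H y) = y" "C1_on a V1"
    using C1_local_inverse[OF open_UNIV UNIV_I H(1) DH H(2)[OF DH]] by metis
  obtain U2 V2 b where 2: "open U2" "u \<in> U2" "open V2" "E ` U2 = V2"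
    "\<And>y. y \<in> U2 \<Longrightarrow> b (E y) = y" "C1_on b V2"
    using C1_local_inverse[OF open_UNIV UNIV_I E(1) DE E(2)[OF DE]] by metis
  \<comment> \<open>Two points of a ball of radius 1/2 have distance less than 1 and so do not
    differ by a nonzero lattice vector. Hence \<open>torus_proj\<close> is injective on the image of
    \<open>U\<close> under \<open>E\<close>.\<close>
  define U where "U = U1 \<inter> U2 \<inter> E -` ball (E u) (1 / 2)"
  have oE: "open (E -` ball (E u) (1 / 2))"
    using C1_on_imp_continuous_on[OF E(1)] by (intro open_vimage) auto
  have uU: "u \<in> U" using 1 2 by (simp add: U_def)
  have small: "E y = E z" if "y \<in> U" "z \<in> U" "lattice_rel (E y) (E z)" for y z
    using that dist_triangle_half_r[of "E u" "E y" 1 "E z"]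
    by (intro lattice_rel_small_imp_eq) (auto simp: U_def)
  have oHU: "open (H ` U)"
  proof -
    have "H ` U = V1 \<inter> a -` (U2 \<inter> E -` ball (E u) (1 / 2))"
      using 1(4,5) by (auto simp: U_def)
    moreover have "open (V1 \<inter> a -` (U2 \<inter> E -` ball (E u) (1 / 2)))"
      using 1(3) C1_on_imp_continuous_on[OF 1(6)] 2(1) oE
      by (intro continuous_open_preimage open_Int) auto
    ultimately show ?thesis by simp
  qed
  have oEU: "open (E ` U)"
  proof -
    have "E ` U = V2 \<inter> b -` (U1 \<inter> E -` ball (E u) (1 / 2))"
      using 2(4,5) by (auto simp: U_def)
    moreover have "open (V2 \<inter> b -` (U1 \<inter> E -` ball (E u) (1 / 2)))"
      using 2(3) C1_on_imp_continuous_on[OF 2(6)] 1(1) oE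
      by (intro continuous_open_preimage open_Int) auto
    ultimately show ?thesis by simp
  qed
  define V where "V = torus_proj ` E ` U"
  define lift where "lift x = (SOME y. y \<in> U \<and> torus_proj (E y) = x)" for x
  define h where "h x = H (lift x)" for x
  have lift: "lift (torus_proj (E y)) = y" if "y \<in> U" for y
  proof -
    have *: "lift (torus_proj (E y)) \<in> U \<and>
        torus_proj (E (lift (torus_proj (E y)))) = torus_proj (E y)"
      unfolding lift_def by (rule someI[of _ y]) (simp add: that)
    then have "E (lift (torus_proj (E y))) = E y"
      using small that by (simp add: torus_proj_eq_iff)
    then show ?thesis using * that 2(5) by (metis IntD1 IntD2 U_def)
  qed
  have oV: "open V" unfolding V_def by (rule open_torus_proj_image[OF oEU])
  have "C1_to_torus_on f (H ` U)"
    unfolding C1_to_torus_on_def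
  proof
    fix x assume x: "x \<in> H ` U"
    have "C1_on (\<lambda>y. E (a y)) (H ` U)"
      using C1_on_compose[OF E(1) C1_on_subset[OF 1(6), of "H ` U"]] 1(4)
      by (auto simp: U_def)
    then have "Ck_on 1 (\<lambda>y. E (a y)) (H ` U)"
      using C1_on_iff_Ck_on_1[OF oHU] by blast
    moreover have "f y = torus_proj (E (a y))" if "y \<in> H ` U" for y
      using that 1(5) f by (auto simp: U_def)
    ultimately show "\<exists>W c. open W \<and> x \<in> W \<and> W \<subseteq> H ` U \<and> Ck_on 1 c W \<and>
        (\<forall>y\<in>W. f y = torus_proj (c y))"
      using oHU x by blast
  qed
  moreover have "C1_from_torus_on h V"
  proof -
    have "open (torus_proj -` V)" using oV by (simp add: open_torus_def)
    moreover have "C1_on (h \<circ> torus_proj) (torus_proj -` V)"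
    proof (rule C1_on_localI)
      fix q assume "q \<in> torus_proj -` V"
      then obtain y where y: "y \<in> U" "torus_proj q = torus_proj (E y)" by (auto simp: V_def)
      \<comment> \<open>\<open>C1_from_torus_on\<close> tests the whole preimage of
        \<open>V\<close>, which has one sheet for each lattice vector. The sheet through
        \<open>q\<close> is the translate by \<open>k\<close>, on which \<open>E\<close> is inverted
        by \<open>b (z - k)\<close>.\<close>
      define k where "k = q - E y"
      have k: "k $ i \<in> \<int>" for i
        using y(2) by (auto simp: k_def torus_proj_eq_iff lattice_rel_def)
      define W where "W = (+) k ` E ` U"
      have "open W" unfolding W_def by (rule open_translation[OF oEU])
      moreover have "q \<in> W" using y(1) by (auto simp: W_def k_def)
      moreover have "C1_on (h \<circ> torus_proj) W"
      proof (rule C1_on_cong[OF \<open>open W\<close>])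
        fix z assume "z \<in> W"
        then obtain v where v: "v \<in> U" "z = E v + k" by (auto simp: W_def add.commute)
        then have "torus_proj z = torus_proj (E v)" using k torus_proj_add_lattice by blast
        then show "(h \<circ> torus_proj) z = H (b (z - k))"
          using v lift[OF v(1)] 2(5) by (simp add: h_def U_def)
      next
        have "C1_on (\<lambda>z. b (z - k)) W"
          by (rule C1_on_compose[OF 2(6) C1_on_diff[OF C1_on_ident C1_on_const]])
            (use 2(4) in \<open>auto simp: W_def U_def\<close>)
        then show "C1_on (\<lambda>z. H (b (z - k))) W"
          by (rule C1_on_compose[OF H(1)]) auto
      qed
      ultimately show "\<exists>W. open W \<and> q \<in> W \<and> C1_on (h \<circ> torus_proj) W" by blast
    qed
    ultimately show ?thesis
      unfolding C1_from_torus_on_def using C1_on_iff_Ck_on_1 by blast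
  qed
  moreover have "f ` H ` U = V"
    by (simp add: V_def image_image f)
  moreover have "\<forall>y\<in>H ` U. h (f y) = y"
    using lift by (simp add: h_def f)
  moreover have "w \<in> H ` U" using uU u by blast
  ultimately show "\<exists>U V h. open U \<and> w \<in> U \<and> open V \<and> f ` U = V \<and> (\<forall>y\<in>U. h (f y) = y) \<and>
      C1_to_torus_on f U \<and> C1_from_torus_on h V"
    using oHU oV by blast
qed

section \<open>The metric in coordinates\<close>

lemma matrix_inv_2:
  fixes A :: "real^2^2"
  assumes d: "det A \<noteq> 0"
  shows "matrix_inv A $ 1 $ 1 = A $ 2 $ 2 / det A" "matrix_inv A $ 1 $ 2 = - (A $ 1 $ 2) / det A"
    "matrix_inv A $ 2 $ 1 = - (A $ 2 $ 1) / det A" "matrix_inv A $ 2 $ 2 = A $ 1 $ 1 / det A"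
proof -
  define B :: "real^2^2" where
    "B = vector [vector [A $ 2 $ 2 / det A, - (A $ 1 $ 2) / det A],
                 vector [- (A $ 2 $ 1) / det A, A $ 1 $ 1 / det A]]"
  have "A $ 1 $ 1 * A $ 2 $ 2 = det A + A $ 1 $ 2 * A $ 2 $ 1"
    by (simp add: det_2)
  then have "A ** B = mat 1"
    using d by (simp add: B_def vec_eq_iff forall_2 matrix_matrix_mult_def sum_2 mat_def
        field_simps)
  moreover have "matrix_inv A ** A = mat 1"
    using d someI_ex[of "\<lambda>A'. A ** A' = mat 1 \<and> A' ** A = mat 1"]
    by (simp add: matrix_inv_def flip: invertible_det_nz invertible_def)
  ultimately have "matrix_inv A = B"
    by (metis matrix_mul_assoc matrix_mul_lid matrix_mul_rid)
  then show "matrix_inv A $ 1 $ 1 = A $ 2 $ 2 / det A"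
    "matrix_inv A $ 1 $ 2 = - (A $ 1 $ 2) / det A"
    "matrix_inv A $ 2 $ 1 = - (A $ 2 $ 1) / det A" "matrix_inv A $ 2 $ 2 = A $ 1 $ 1 / det A"
    by (simp_all add: B_def)
qed

locale torus_metric =
  fixes g :: metric
  assumes metric: "riemannian_metric g"
begin

definition gram :: "2 \<Rightarrow> 2 \<Rightarrow> real^2 \<Rightarrow> real" where
  "gram i j p = g (torus_proj p) $ i $ j"

definition dgram :: "2 \<Rightarrow> 2 \<Rightarrow> 2 \<Rightarrow> real^2 \<Rightarrow> real" where
  "dgram m i j p = frechet_derivative (gram i j) (at p) (axis m 1)"

definition gdet :: "real^2 \<Rightarrow> real" where
  "gdet p = gram 1 1 p * gram 2 2 p - gram 1 2 p * gram 1 2 p"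

abbreviation nrm :: "real^2 \<Rightarrow> real^2 \<Rightarrow> real" where
  "nrm p v \<equiv> metric_norm g (torus_proj p) v"

lemma gram_sym: "gram 2 1 p = gram 1 2 p"
proof -
  have "metric_inner g (torus_proj p) (axis 1 1) (axis 2 1)
      = metric_inner g (torus_proj p) (axis 2 1) (axis 1 1)"
    using metric by (simp add: riemannian_metric_def)
  then show ?thesis
    by (simp add: metric_inner_def inner_vec_def matrix_vector_mult_def sum_2 axis_def gram_def)
qed

lemma metric_inner_gram:
  "metric_inner g (torus_proj p) v w = gram 1 1 p * v $ 1 * w $ 1
     + gram 1 2 p * (v $ 1 * w $ 2 + v $ 2 * w $ 1) + gram 2 2 p * v $ 2 * w $ 2"
  using gram_sym[of p]
  by (simp add: metric_inner_def inner_vec_def matrix_vector_mult_def sum_2 gram_def algebra_simps)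

lemma metric_inner_pos: "v \<noteq> 0 \<Longrightarrow> metric_inner g x v v > 0"
  using metric by (simp add: riemannian_metric_def)

lemma metric_norm_pos: "v \<noteq> 0 \<Longrightarrow> metric_norm g x v > 0"
  by (simp add: metric_norm_def metric_inner_pos)

lemma metric_norm_scaleR: "metric_norm g x (r *\<^sub>R v) = \<bar>r\<bar> * metric_norm g x v"
proof -
  have "metric_inner g x (r *\<^sub>R v) (r *\<^sub>R v) = r\<^sup>2 * metric_inner g x v v"
    by (simp add: metric_inner_def matrix_vector_mult_scaleR power2_eq_square)
  then show ?thesis by (simp add: metric_norm_def real_sqrt_mult)
qed

lemma gdet_pos: "gdet p > 0"
proof -
  define a b c where "a = gram 1 1 p" and "b = gram 1 2 p" and "c = gram 2 2 p"
  have a: "a > 0"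
    using metric_inner_pos[of "axis 1 1" "torus_proj p"]
    by (simp add: metric_inner_gram axis_def vec_eq_iff a_def)
  have "(vector [- b, a] :: real^2) \<noteq> 0"
    using a by (auto simp: vec_eq_iff forall_2)
  from metric_inner_pos[OF this, of "torus_proj p"] have "a * (a * c - b * b) > 0"
    by (simp add: metric_inner_gram algebra_simps a_def b_def c_def)
  then show ?thesis
    using a by (simp add: zero_less_mult_iff gdet_def a_def b_def c_def)
qed

lemma det_gram: "det (g (torus_proj p)) = gdet p"
  using gram_sym[of p] by (simp add: det_2 gdet_def gram_def)

lemma Ck_on_gram: "Ck_on k (gram i j) UNIV"
proof -
  have "Ck_on k (g \<circ> torus_proj) UNIV"
    using metric by (simp add: riemannian_metric_def smooth_on_def)
  moreover have "bounded_linear (\<lambda>A :: real^2^2. A $ i $ j)"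
    by (intro bounded_linear_compose[OF bounded_linear_vec_nth] bounded_linear_vec_nth)
  ultimately have "Ck_on k (\<lambda>p. (g \<circ> torus_proj) p $ i $ j) UNIV"
    using Ck_on_bounded_linear_compose[OF _ open_UNIV] by blast
  then show ?thesis by (simp add: gram_def[abs_def])
qed

lemma gram_has_derivative:
  "(gram i j has_derivative (\<lambda>v. v $ 1 * dgram 1 i j p + v $ 2 * dgram 2 i j p)) (at p)"
proof -
  have d: "(gram i j has_derivative frechet_derivative (gram i j) (at p)) (at p)"
    using Ck_on_SucD(1)[OF Ck_on_gram] by blast
  then interpret D: bounded_linear "frechet_derivative (gram i j) (at p)"
    by (rule has_derivative_bounded_linear)
  have "v = v $ 1 *\<^sub>R axis 1 1 + v $ 2 *\<^sub>R axis 2 1" for v :: "real^2"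
    by (simp add: vec_eq_iff forall_2 axis_def)
  then have "frechet_derivative (gram i j) (at p) v = v $ 1 * dgram 1 i j p + v $ 2 * dgram 2 i j p"
    for v by (metis D.add D.scaleR dgram_def real_scaleR_def)
  then have "frechet_derivative (gram i j) (at p)
      = (\<lambda>v. v $ 1 * dgram 1 i j p + v $ 2 * dgram 2 i j p)"
    by (rule ext)
  with d show ?thesis by simp
qed

lemma Ck_on_dgram: "Ck_on k (dgram m i j) UNIV"
  using Ck_on_SucD(2)[OF Ck_on_gram] by (simp add: dgram_def[abs_def])

text \<open>\<open>torus_partial\<close> differentiates at the representative chosen by
  \<open>torus_rep\<close>; periodicity carries the derivative from there to
  \<open>p\<close>.\<close>

lemma torus_partial_gram: "torus_partial m (\<lambda>y. g y $ i $ j) (torus_proj p) = dgram m i j p"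
proof -
  define q where "q = torus_rep (torus_proj p)"
  have "torus_proj q = torus_proj p" by (simp add: q_def torus_proj_rep)
  then have k: "(q - p) $ i \<in> \<int>" for i by (simp add: torus_proj_eq_iff lattice_rel_def)
  have "gram i j (u + (q - p)) = gram i j u" for u
    using torus_proj_add_lattice[OF k] by (simp add: gram_def)
  moreover have "((\<lambda>u. gram i j (u + (q - p))) has_derivative
      (\<lambda>v. v $ 1 * dgram 1 i j q + v $ 2 * dgram 2 i j q)) (at p)"
  proof (rule has_derivative_compose[where f="\<lambda>u. u + (q - p)"])
    show "((\<lambda>u. u + (q - p)) has_derivative (\<lambda>v. v)) (at p)"
      by (auto intro!: derivative_eq_intros)
    show "(gram i j has_derivative (\<lambda>v. v $ 1 * dgram 1 i j q + v $ 2 * dgram 2 i j q))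
        (at (p + (q - p)))"
      using gram_has_derivative by simp
  qed
  ultimately have "(gram i j has_derivative
      (\<lambda>v. v $ 1 * dgram 1 i j q + v $ 2 * dgram 2 i j q)) (at p)"
    by simp
  from fun_cong[OF frechet_derivative_at[OF this], of "axis m 1"]
    fun_cong[OF frechet_derivative_at[OF gram_has_derivative[of i j q]], of "axis m 1"]
  have "dgram m i j p = dgram m i j q"
    by (simp add: dgram_def)
  then show ?thesis
    by (simp add: torus_partial_def dgram_def q_def gram_def[abs_def] o_def)
qed

section \<open>Covariant acceleration and geodesic curvature\<close>

definition Gam :: "torus \<Rightarrow> real^2 \<Rightarrow> real^2" where
  "Gam x v = (\<chi> k. \<Sum>i\<in>UNIV. \<Sum>j\<in>UNIV. christoffel g x k i j * v $ i * v $ j)"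

text \<open>Christoffel symbols of the first kind contracted with \<open>v\<close> twice:
  \<open>lowGam1\<close> and \<open>lowGam2\<close> are the inner products of \<open>Gam\<close>
  with the coordinate fields, free of the inverse Gram matrix.\<close>

definition lowGam1 :: "real^2 \<Rightarrow> real^2 \<Rightarrow> real" where
  "lowGam1 p v = dgram 1 1 1 p * v $ 1 * v $ 1 / 2 + dgram 2 1 1 p * v $ 1 * v $ 2
     + (dgram 2 1 2 p - dgram 1 2 2 p / 2) * v $ 2 * v $ 2"

definition lowGam2 :: "real^2 \<Rightarrow> real^2 \<Rightarrow> real" where
  "lowGam2 p v = (dgram 1 1 2 p - dgram 2 1 1 p / 2) * v $ 1 * v $ 1
     + dgram 1 2 2 p * v $ 1 * v $ 2 + dgram 2 2 2 p * v $ 2 * v $ 2 / 2"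

lemma dgram_sym: "dgram m 2 1 p = dgram m 1 2 p"
  by (simp add: dgram_def gram_sym[abs_def])

lemma Gam_gram:
  "Gam (torus_proj p) v $ 1 = (gram 2 2 p * lowGam1 p v - gram 1 2 p * lowGam2 p v) / gdet p"
  "Gam (torus_proj p) v $ 2 = (gram 1 1 p * lowGam2 p v - gram 1 2 p * lowGam1 p v) / gdet p"
proof -
  have d: "det (g (torus_proj p)) \<noteq> 0" using gdet_pos[of p] by (simp add: det_gram)
  show "Gam (torus_proj p) v $ 1 = (gram 2 2 p * lowGam1 p v - gram 1 2 p * lowGam2 p v) / gdet p"
    "Gam (torus_proj p) v $ 2 = (gram 1 1 p * lowGam2 p v - gram 1 2 p * lowGam1 p v) / gdet p"
    unfolding Gam_def christoffel_def torus_partial_gram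
    using gdet_pos[of p]
    by (simp_all add: sum_2 matrix_inv_2[OF d] det_gram gram_sym dgram_sym lowGam1_def lowGam2_def
        field_simps flip: gram_def)
qed

text \<open>The geodesic curvature with respect to \<open>g\<close> of a curve of unit speed \<open>v\<close> whose coordinate
  acceleration \<open>a\<close> satisfies \<open>v\<^sub>1 a\<^sub>2 - v\<^sub>2 a\<^sub>1 = |v| v\<^sub>2\<^sup>2\<close>, as for catenaries.\<close>

definition catenary_lambda :: "torus \<times> (real^2) \<Rightarrow> real" where
  "catenary_lambda z = (case z of (x, v) \<Rightarrow> sqrt (det (g x)) *
     (v $ 1 * Gam x v $ 2 - v $ 2 * Gam x v $ 1 + norm v * (v $ 2)\<^sup>2))"

text \<open>Away from \<open>v = 0\<close> the Euclidean norm is smooth too; unit vectors are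
  nonzero, so this open set carries the smooth extension required by
  \<open>smooth_on_unit_tangent\<close>.\<close>

lemma Ck_on_catenary_lambda:
  "Ck_on k (\<lambda>z. catenary_lambda (torus_proj (fst z), snd z)) (UNIV \<times> - {0})"
proof -
  define S :: "((real^2) \<times> (real^2)) set" where "S = UNIV \<times> - {0}"
  have S: "open S" unfolding S_def by (intro open_Times) auto
  have v: "Ck_on k (\<lambda>z. snd z $ i) S" for i
    by (intro Ck_on_bounded_linear bounded_linear_compose[OF bounded_linear_vec_nth]
        bounded_linear_snd S)
  have gr: "Ck_on k (\<lambda>z. gram i j (fst z)) S" for i j
    by (rule Ck_on_compose_bounded_linear[OF bounded_linear_fst S _ Ck_on_gram]) simp
  have dgr: "Ck_on k (\<lambda>z. dgram m i j (fst z)) S" for m i j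
    by (rule Ck_on_compose_bounded_linear[OF bounded_linear_fst S _ Ck_on_dgram]) simp
  have det: "Ck_on k (\<lambda>z. gram 1 1 (fst z) * gram 2 2 (fst z)
      + (- 1) * (gram 1 2 (fst z) * gram 1 2 (fst z))) S"
    by (intro Ck_on_add Ck_on_mult Ck_on_const gr S)
  have det_eq: "gram 1 1 p * gram 2 2 p + (- 1) * (gram 1 2 p * gram 1 2 p) = gdet p" for p
    by (simp add: gdet_def)
  note det = det[unfolded det_eq]
  have sdet: "Ck_on k (\<lambda>z. sqrt (gdet (fst z))) S"
    by (rule Ck_on_sqrt[OF S _ det]) (simp add: gdet_pos)
  have idet: "Ck_on k (\<lambda>z. inverse (gdet (fst z))) S"
    by (rule Ck_on_inverse[OF S _ det]) (metis gdet_pos less_irrefl)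
  have nv: "Ck_on k (\<lambda>z. sqrt (snd z $ 1 * snd z $ 1 + snd z $ 2 * snd z $ 2)) S"
  proof (rule Ck_on_sqrt[OF S])
    show "0 < snd z $ 1 * snd z $ 1 + snd z $ 2 * snd z $ 2" if "z \<in> S" for z
      using that by (auto simp: S_def vec_eq_iff forall_2 sum_squares_gt_zero_iff)
    show "Ck_on k (\<lambda>z. snd z $ 1 * snd z $ 1 + snd z $ 2 * snd z $ 2) S"
      by (intro Ck_on_add Ck_on_mult v S)
  qed
  have "Ck_on k (\<lambda>z. dgram 1 1 1 (fst z) * snd z $ 1 * snd z $ 1 * (1 / 2)
      + dgram 2 1 1 (fst z) * snd z $ 1 * snd z $ 2
      + (dgram 2 1 2 (fst z) + dgram 1 2 2 (fst z) * (- 1 / 2)) * snd z $ 2 * snd z $ 2) S"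
    by (intro Ck_on_add Ck_on_mult Ck_on_const v dgr S)
  then have l1: "Ck_on k (\<lambda>z. lowGam1 (fst z) (snd z)) S" by (simp add: lowGam1_def)
  have "Ck_on k (\<lambda>z. (dgram 1 1 2 (fst z) + dgram 2 1 1 (fst z) * (- 1 / 2)) * snd z $ 1 * snd z $ 1
      + dgram 1 2 2 (fst z) * snd z $ 1 * snd z $ 2
      + dgram 2 2 2 (fst z) * snd z $ 2 * snd z $ 2 * (1 / 2)) S"
    by (intro Ck_on_add Ck_on_mult Ck_on_const v dgr S)
  then have l2: "Ck_on k (\<lambda>z. lowGam2 (fst z) (snd z)) S" by (simp add: lowGam2_def)
  have "Ck_on k (\<lambda>z. sqrt (gdet (fst z)) * (snd z $ 1 * ((gram 1 1 (fst z) * lowGam2 (fst z) (snd z)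
        + (- 1) * (gram 1 2 (fst z) * lowGam1 (fst z) (snd z))) * inverse (gdet (fst z)))
      + (- 1) * (snd z $ 2 * ((gram 2 2 (fst z) * lowGam1 (fst z) (snd z)
        + (- 1) * (gram 1 2 (fst z) * lowGam2 (fst z) (snd z))) * inverse (gdet (fst z))))
      + sqrt (snd z $ 1 * snd z $ 1 + snd z $ 2 * snd z $ 2) * (snd z $ 2 * snd z $ 2))) S"
    by (intro Ck_on_add Ck_on_mult Ck_on_const v gr l1 l2 sdet idet nv S)
  then show ?thesis
    by (simp add: catenary_lambda_def det_gram Gam_gram norm_vec_def L2_set_def sum_2
        power2_eq_square divide_inverse S_def)
qed

lemma smooth_catenary_lambda: "smooth_on_unit_tangent g catenary_lambda"
  unfolding smooth_on_unit_tangent_def smooth_on_subset_def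
proof
  fix z :: "(real^2) \<times> (real^2)"
  assume "z \<in> {(p, v). (torus_proj p, v) \<in> unit_tangent g}"
  then have "z \<in> UNIV \<times> - {0}"
    by (auto simp: unit_tangent_def metric_norm_def metric_inner_def)
  moreover have "open (UNIV \<times> - {0} :: ((real^2) \<times> (real^2)) set)"
    by (intro open_Times) auto
  moreover have "smooth_on (\<lambda>(p, v). catenary_lambda (torus_proj p, v)) (UNIV \<times> - {0})"
    using Ck_on_catenary_lambda by (simp add: smooth_on_def case_prod_unfold)
  ultimately show "\<exists>U h. open U \<and> z \<in> U \<and> smooth_on h U \<and>
      (\<forall>y\<in>{(p, v). (torus_proj p, v) \<in> unit_tangent g} \<inter> U.
        h y = (case y of (p, v) \<Rightarrow> catenary_lambda (torus_proj p, v)))"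
    by blast
qed

lemma rotJ_gram:
  "rotJ g (torus_proj p) v $ 1 = - (gram 1 2 p * v $ 1 + gram 2 2 p * v $ 2) / sqrt (gdet p)"
  "rotJ g (torus_proj p) v $ 2 = (gram 1 1 p * v $ 1 + gram 1 2 p * v $ 2) / sqrt (gdet p)"
  by (simp_all add: rotJ_def det_gram matrix_vector_mult_def sum_2 gram_sym flip: gram_def)

text \<open>In dimension two a curve of constant speed is determined by its geodesic curvature: its
  covariant acceleration is orthogonal to the velocity \<open>v\<close>, hence a multiple of \<open>Jv\<close>, and the
  factor is read off the area spanned with \<open>v\<close>.\<close>

lemma thermostat_field_eqI:
  fixes v A :: "real^2"
  assumes v: "nrm p v = 1"
    and orth: "metric_inner g (torus_proj p) v (A + Gam (torus_proj p) v) = 0"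
    and area: "v $ 1 * A $ 2 - v $ 2 * A $ 1 = norm v * (v $ 2)\<^sup>2"
  shows "thermostat_field g catenary_lambda (torus_proj p, v) = (v, A)"
proof -
  define a b c r where "a = gram 1 1 p" and "b = gram 1 2 p" and "c = gram 2 2 p"
    and "r = sqrt (gdet p)"
  define B where "B = A + Gam (torus_proj p) v"
  define \<kappa> where "\<kappa> = v $ 1 * B $ 2 - v $ 2 * B $ 1"
  have r: "r > 0" using gdet_pos[of p] by (simp add: r_def)
  have l: "catenary_lambda (torus_proj p, v) = r * \<kappa>"
    using area by (simp add: catenary_lambda_def \<kappa>_def B_def det_gram r_def algebra_simps)
  have 1: "a * v $ 1 * v $ 1 + b * (v $ 1 * v $ 2 + v $ 2 * v $ 1) + c * v $ 2 * v $ 2 = 1"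
    using v by (simp add: metric_norm_def metric_inner_gram a_def b_def c_def)
  have 0: "a * v $ 1 * B $ 1 + b * (v $ 1 * B $ 2 + v $ 2 * B $ 1) + c * v $ 2 * B $ 2 = 0"
    using orth by (simp add: metric_inner_gram a_def b_def c_def flip: B_def)
  \<comment> \<open>Fact \<open>0\<close> and the definition of \<open>\<kappa>\<close> are two
    linear equations for \<open>B\<close>; their determinant is the left-hand side of fact
    \<open>1\<close>.\<close>
  have "B $ 1 = - (b * v $ 1 + c * v $ 2) * \<kappa>" "B $ 2 = (a * v $ 1 + b * v $ 2) * \<kappa>"
    unfolding \<kappa>_def using 0 1 by algebra+
  then have "B = catenary_lambda (torus_proj p, v) *\<^sub>R rotJ g (torus_proj p) v"
    using r by (simp add: vec_eq_iff forall_2 rotJ_gram l flip: a_def b_def c_def r_def)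
  then have "A = catenary_lambda (torus_proj p, v) *\<^sub>R rotJ g (torus_proj p) v
      - Gam (torus_proj p) v"
    by (simp add: B_def algebra_simps)
  then show ?thesis
    by (simp add: thermostat_field_def geodesic_field_def vertical_field_def Gam_def vec_eq_iff)
qed

lemma metric_inner_Gam:
  "metric_inner g (torus_proj p) v (Gam (torus_proj p) v) = v $ 1 * lowGam1 p v + v $ 2 * lowGam2 p v"
proof -
  have d: "gdet p \<noteq> 0" using gdet_pos[of p] by simp
  have "gdet p * metric_inner g (torus_proj p) v (Gam (torus_proj p) v)
      = gdet p * (v $ 1 * lowGam1 p v + v $ 2 * lowGam2 p v)"
    using d unfolding metric_inner_gram Gam_gram
    by (simp add: field_simps) (simp add: gdet_def algebra_simps)
  then show ?thesis using d by simp
qed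

end

section \<open>Catenaries\<close>

text \<open>\<open>catenary_velocity s v\<close> solves \<open>W' = (- |W| W\<^sub>2, 0)\<close> with \<open>W(0) = v\<close>: the velocity of a
  catenary (or of a straight line, if \<open>v\<^sub>2 = 0\<close>) in the flat plane.\<close>

definition catenary_velocity :: "real \<Rightarrow> real^2 \<Rightarrow> real^2" where
  "catenary_velocity s v = vector [v $ 1 * cosh (v $ 2 * s) - norm v * sinh (v $ 2 * s), v $ 2]"

text \<open>The integral of the velocity from 0 to \<open>s\<close>, in the form of
  \<open>has_vector_derivative_scaled_integral\<close>. Its closed form would divide by
  \<open>v $ 2\<close>; the integral includes the straight lines.\<close>

definition catenary :: "real \<Rightarrow> real^2 \<Rightarrow> real^2" where
  "catenary s v = s *\<^sub>R integral {0..1} (\<lambda>t. catenary_velocity (t * s) v)"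

lemma catenary_velocity_nth [simp]:
  "catenary_velocity s v $ 1 = v $ 1 * cosh (v $ 2 * s) - norm v * sinh (v $ 2 * s)"
  "catenary_velocity s v $ 2 = v $ 2"
  by (simp_all add: catenary_velocity_def)

lemma norm_2: "norm (v :: real^2) = sqrt ((v $ 1)\<^sup>2 + (v $ 2)\<^sup>2)"
  by (simp add: norm_vec_def L2_set_def sum_2)

lemma cosh_minus_abs_sinh: "cosh (x :: real) - \<bar>sinh x\<bar> = exp (- \<bar>x\<bar>)"
  by (simp add: cosh_def sinh_def abs_if field_simps)

lemma catenary_norm_lower:
  "norm v * exp (- \<bar>v $ 2 * s\<bar>) \<le> norm v * cosh (v $ 2 * s) - v $ 1 * sinh (v $ 2 * s)"
proof -
  have "v $ 1 * sinh (v $ 2 * s) \<le> \<bar>v $ 1\<bar> * \<bar>sinh (v $ 2 * s)\<bar>"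
    by (simp add: abs_mult[symmetric])
  also have "\<dots> \<le> norm v * \<bar>sinh (v $ 2 * s)\<bar>"
    using component_le_norm_cart by (intro mult_right_mono) auto
  finally show ?thesis by (simp add: algebra_simps flip: cosh_minus_abs_sinh)
qed

text \<open>The pair of first component and norm undergoes a hyperbolic rotation by
  \<open>v $ 2 * s\<close>, which preserves the difference of squares
  \<open>(v $ 2)\<^sup>2\<close>. The estimate \<open>catenary_norm_lower\<close> settles the sign
  of the root.\<close>

lemma norm_catenary_velocity:
  "norm (catenary_velocity s v) = norm v * cosh (v $ 2 * s) - v $ 1 * sinh (v $ 2 * s)"
proof -
  define c h where "c = cosh (v $ 2 * s)" and "h = sinh (v $ 2 * s)"
  have ch: "c\<^sup>2 = h\<^sup>2 + 1" unfolding c_def h_def by (rule cosh_square_eq)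
  have n: "(norm v)\<^sup>2 = (v $ 1)\<^sup>2 + (v $ 2)\<^sup>2" by (simp add: norm_2)
  have "0 \<le> norm v * c - v $ 1 * h"
    unfolding c_def h_def by (rule order_trans[OF _ catenary_norm_lower]) simp
  moreover have "(v $ 1 * c - norm v * h)\<^sup>2 + (v $ 2)\<^sup>2 = (norm v * c - v $ 1 * h)\<^sup>2"
    using ch n by algebra
  ultimately show ?thesis by (simp add: norm_2[of "catenary_velocity s v"] c_def h_def)
qed

lemma catenary_velocity_nonzero: "v \<noteq> 0 \<Longrightarrow> catenary_velocity s v \<noteq> 0"
proof -
  assume "v \<noteq> 0"
  then have "0 < norm v * exp (- \<bar>v $ 2 * s\<bar>)" by simp
  also have "\<dots> \<le> norm (catenary_velocity s v)"
    unfolding norm_catenary_velocity by (rule catenary_norm_lower)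
  finally show ?thesis by simp
qed

text \<open>The bound must be uniform in \<open>s\<close>, unlike the exponential one, because it
  later makes the arc length unbounded in both directions.\<close>

lemma catenary_velocity_lower:
  assumes "v \<noteq> 0"
  obtains k where "k > 0" "\<And>s. k \<le> norm (catenary_velocity s v)"
proof (cases "v $ 2 = 0")
  case True
  then show thesis using that[of "norm v"] assms by (simp add: norm_catenary_velocity)
next
  case False
  have "\<bar>v $ 2\<bar> \<le> norm (catenary_velocity s v)" for s
    using component_le_norm_cart[of "catenary_velocity s v" 2] by simp
  then show thesis using that[of "\<bar>v $ 2\<bar>"] False by simp
qed

lemma catenary_velocity_0 [simp]: "catenary_velocity 0 v = v"
  by (simp add: vec_eq_iff forall_2)

lemma catenary_velocity_has_derivative:
  "((\<lambda>s. catenary_velocity s v) has_vector_derivative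
     vector [- norm (catenary_velocity s v) * v $ 2, 0]) (at s)"
proof -
  have eq: "catenary_velocity s v
      = (v $ 1 * cosh (v $ 2 * s) - norm v * sinh (v $ 2 * s)) *\<^sub>R axis 1 1 + v $ 2 *\<^sub>R axis 2 1" for s
    by (simp add: vec_eq_iff forall_2 axis_def)
  have "((\<lambda>s. v $ 1 * cosh (v $ 2 * s) - norm v * sinh (v $ 2 * s)) has_real_derivative
      v $ 1 * (sinh (v $ 2 * s) * v $ 2) - norm v * (cosh (v $ 2 * s) * v $ 2)) (at s)"
    by (auto intro!: derivative_eq_intros)
  then have "((\<lambda>s. catenary_velocity s v) has_vector_derivative
      (v $ 1 * (sinh (v $ 2 * s) * v $ 2) - norm v * (cosh (v $ 2 * s) * v $ 2)) *\<^sub>R axis 1 1) (at s)"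
    unfolding eq by (auto intro!: derivative_eq_intros)
  then show ?thesis
    by (rule has_vector_derivative_eq_rhs)
      (simp add: vec_eq_iff forall_2 axis_def norm_catenary_velocity algebra_simps)
qed

text \<open>Homogeneity of degree two: \<open>r v\<close> runs along the curve of \<open>v\<close>,
  but \<open>r\<close> times as fast. For negative \<open>r\<close> this fails, since curves with
  even curvature are not reversible.\<close>

lemma catenary_velocity_scaleR:
  "r \<ge> 0 \<Longrightarrow> catenary_velocity s (r *\<^sub>R v) = r *\<^sub>R catenary_velocity (s * r) v"
  by (simp add: vec_eq_iff forall_2 algebra_simps)

lemma continuous_on_catenary_velocity: "continuous_on S (\<lambda>s. catenary_velocity s v)"
  using catenary_velocity_has_derivative has_vector_derivative_continuous
  by (blast intro: continuous_at_imp_continuous_on)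

lemma C1_on_catenary_velocity:
  fixes s :: "'a::euclidean_space \<Rightarrow> real"
  assumes "C1_on s S" "C1_on v S" "\<And>x. x \<in> S \<Longrightarrow> v x \<noteq> 0"
  shows "C1_on (\<lambda>x. catenary_velocity (s x) (v x)) S"
proof -
  have eq: "catenary_velocity s v
      = (v $ 1 * cosh (v $ 2 * s) - norm v * sinh (v $ 2 * s)) *\<^sub>R axis 1 1 + v $ 2 *\<^sub>R axis 2 1" for s v
    by (simp add: vec_eq_iff forall_2 axis_def)
  have nth: "C1_on (\<lambda>x. v x $ i) S" for i
    by (rule C1_on_compose_bounded_linear[OF bounded_linear_vec_nth assms(2)])
  show ?thesis
    unfolding eq
    by (intro C1_on_add C1_on_diff C1_on_scaleR C1_on_mult C1_on_cosh C1_on_sinh C1_on_norm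
        C1_on_const nth assms)
qed

lemma C1_on_catenary_mean:
  "C1_on (\<lambda>z. integral {0..1} (\<lambda>t. catenary_velocity (t * fst z) (snd z))) (UNIV \<times> - {0})"
  by (intro C1_on_integral C1_on_catenary_velocity C1_on_mult C1_on_fst C1_on_snd C1_on_ident
      open_Times) auto

lemma C1_on_catenary:
  fixes s :: "'a::euclidean_space \<Rightarrow> real"
  assumes "C1_on s S" "C1_on v S" "\<And>x. x \<in> S \<Longrightarrow> v x \<noteq> 0"
  shows "C1_on (\<lambda>x. catenary (s x) (v x)) S"
proof -
  have "C1_on (\<lambda>z. catenary (fst z) (snd z)) (UNIV \<times> - {0})"
    unfolding catenary_def by (intro C1_on_scaleR C1_on_catenary_mean C1_on_fst C1_on_ident)
  from C1_on_compose[OF this C1_on_Pair[OF assms(1,2)]] show ?thesis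
    using assms(3) by auto
qed

lemma catenary_has_derivative:
  "((\<lambda>s. catenary s v) has_vector_derivative catenary_velocity s v) (at s)"
  unfolding catenary_def
  by (rule has_vector_derivative_scaled_integral[OF continuous_on_catenary_velocity])

lemma catenary_0 [simp]: "catenary 0 v = 0"
  by (simp add: catenary_def)

lemma catenary_scaleR: "r \<ge> 0 \<Longrightarrow> catenary s (r *\<^sub>R v) = catenary (s * r) v"
  by (simp add: catenary_def catenary_velocity_scaleR mult.assoc)

section \<open>Speed and arc length of catenaries in the metric \<open>g\<close>\<close>

lemma metric_inner_add_right:
  "metric_inner g x v (w + w') = metric_inner g x v w + metric_inner g x v w'"
  by (simp add: metric_inner_def matrix_vector_right_distrib inner_add_right)

lemma metric_inner_scaleR:
  "metric_inner g x (r *\<^sub>R v) w = r * metric_inner g x v w"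
  "metric_inner g x v (r *\<^sub>R w) = r * metric_inner g x v w"
  by (simp_all add: metric_inner_def matrix_vector_mult_scaleR)

context torus_metric
begin

lemma Gam_scaleR: "Gam x (r *\<^sub>R v) = r\<^sup>2 *\<^sub>R Gam x v"
  by (simp add: Gam_def vec_eq_iff sum_2 power2_eq_square algebra_simps)

lemma metric_norm_square: "(metric_norm g x v)\<^sup>2 = metric_inner g x v v"
  using metric_inner_pos[of v x] by (cases "v = 0") (auto simp: metric_norm_def metric_inner_def)

lemma C1_on_gram: "C1_on f S \<Longrightarrow> C1_on (\<lambda>x. gram i j (f x)) S"
  using C1_on_compose[of "gram i j" UNIV f S] C1_on_iff_Ck_on_1[of UNIV "gram i j"] Ck_on_gram
  by simp

lemma C1_on_nrm:
  fixes f :: "'a::euclidean_space \<Rightarrow> real^2"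
  assumes "C1_on f S" "C1_on v S" "\<And>x. x \<in> S \<Longrightarrow> v x \<noteq> 0"
  shows "C1_on (\<lambda>x. nrm (f x) (v x)) S"
proof -
  have nth: "C1_on (\<lambda>x. v x $ i) S" for i
    by (rule C1_on_compose_bounded_linear[OF bounded_linear_vec_nth assms(2)])
  have "C1_on (\<lambda>x. metric_inner g (torus_proj (f x)) (v x) (v x)) S"
    unfolding metric_inner_gram by (intro C1_on_add C1_on_mult C1_on_gram nth assms)
  then show ?thesis
    unfolding metric_norm_def by (rule C1_on_sqrt) (use assms metric_inner_pos in auto)
qed

lemma continuous_on_gram: "continuous_on S f \<Longrightarrow> continuous_on S (\<lambda>x. gram i j (f x))"
  using continuous_on_compose2[of UNIV "gram i j" S f] Ck_on_gram[of 0] by simp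

text \<open>Compactness of the torus, used through the unit square: \<open>frac\<close> moves any
  representative into it.\<close>

lemma metric_norm_lower:
  obtains m where "m > 0" "\<And>x v. m * norm v \<le> metric_norm g x v"
proof -
  define K where "K = cbox (0 :: real^2) 1 \<times> sphere (0 :: real^2) 1"
  have "compact K"
    unfolding K_def by (intro compact_Times compact_cbox compact_sphere)
  moreover have "(0, axis 1 1) \<in> K"
    by (simp add: K_def mem_box_cart norm_axis_1)
  ultimately have K: "compact K" "K \<noteq> {}" by auto
  have "continuous_on K (\<lambda>z. nrm (fst z) (snd z))"
    unfolding metric_norm_def metric_inner_gram
    by (intro continuous_intros continuous_on_gram)
  then obtain z where z: "z \<in> K" "\<And>y. y \<in> K \<Longrightarrow> nrm (fst z) (snd z) \<le> nrm (fst y) (snd y)"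
    using continuous_attains_inf[OF K] by blast
  define m where "m = nrm (fst z) (snd z)"
  have "snd z \<noteq> 0" using z(1) by (auto simp: K_def)
  then have "m > 0" by (simp add: m_def metric_norm_pos)
  moreover have "m * norm v \<le> metric_norm g x v" for x v
  proof (cases "v = 0")
    case True
    then show ?thesis by (simp add: metric_norm_def metric_inner_def)
  next
    case False
    define p :: "real^2" where "p = (\<chi> i. frac (torus_rep x $ i))"
    have "torus_proj p = torus_proj (torus_rep x)"
      unfolding torus_proj_eq_iff lattice_rel_def by (simp add: p_def frac_def)
    then have p: "torus_proj p = x" by (simp add: torus_proj_rep)
    have "p \<in> cbox 0 1"
      by (simp add: mem_box_cart p_def frac_lt_1 less_imp_le)
    then have "m \<le> nrm p ((1 / norm v) *\<^sub>R v)"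
      using z(2)[of "(p, (1 / norm v) *\<^sub>R v)"] False by (simp add: K_def m_def)
    then show ?thesis using False by (simp add: p metric_norm_scaleR field_simps)
  qed
  ultimately show thesis by (rule that)
qed

text \<open>Compatibility of the Levi-Civita connection with the metric: the squared norm of
  \<open>w\<close> has as derivative twice the inner product of \<open>w\<close> with its covariant
  derivative.\<close>

lemma nrm_has_derivative:
  assumes q: "(q has_vector_derivative w s) (at s)" and w: "(w has_vector_derivative w') (at s)"
    and nz: "w s \<noteq> 0"
  shows "((\<lambda>s. nrm (q s) (w s)) has_real_derivative
    metric_inner g (torus_proj (q s)) (w s) (w' + Gam (torus_proj (q s)) (w s)) / nrm (q s) (w s))
    (at s)"
proof -
  define a b c a' b' c' where "a = gram 1 1 (q s)" and "b = gram 1 2 (q s)" and "c = gram 2 2 (q s)"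
    and "a' = w s $ 1 * dgram 1 1 1 (q s) + w s $ 2 * dgram 2 1 1 (q s)"
    and "b' = w s $ 1 * dgram 1 1 2 (q s) + w s $ 2 * dgram 2 1 2 (q s)"
    and "c' = w s $ 1 * dgram 1 2 2 (q s) + w s $ 2 * dgram 2 2 2 (q s)"
  have gr: "((\<lambda>s. gram i j (q s)) has_real_derivative
      w s $ 1 * dgram 1 i j (q s) + w s $ 2 * dgram 2 i j (q s)) (at s)" for i j
    unfolding has_field_derivative_def
    by (rule has_derivative_eq_rhs[OF has_derivative_compose[OF
          q[unfolded has_vector_derivative_def] gram_has_derivative]])
      (simp add: fun_eq_iff algebra_simps)
  have nth: "((\<lambda>s. w s $ i) has_real_derivative w' $ i) (at s)" for i
    using bounded_linear.has_vector_derivative[OF bounded_linear_vec_nth w]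
    by (simp add: has_real_derivative_iff_has_vector_derivative)
  have "((\<lambda>s. metric_inner g (torus_proj (q s)) (w s) (w s)) has_real_derivative
      a' * w s $ 1 * w s $ 1 + 2 * b' * w s $ 1 * w s $ 2 + c' * w s $ 2 * w s $ 2
      + 2 * (a * w s $ 1 * w' $ 1 + b * (w s $ 1 * w' $ 2 + w s $ 2 * w' $ 1) + c * w s $ 2 * w' $ 2))
      (at s)"
    unfolding metric_inner_gram
    by (rule derivative_eq_intros gr nth refl)+
      (simp add: a_def b_def c_def a'_def b'_def c'_def algebra_simps)
  then have "((\<lambda>s. metric_inner g (torus_proj (q s)) (w s) (w s)) has_real_derivative
      2 * metric_inner g (torus_proj (q s)) (w s) (w' + Gam (torus_proj (q s)) (w s))) (at s)"
    unfolding metric_inner_add_right metric_inner_Gam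
    by (rule DERIV_cong)
      (simp add: metric_inner_gram lowGam1_def lowGam2_def
        a_def b_def c_def a'_def b'_def c'_def algebra_simps)
  from DERIV_chain2[OF DERIV_real_sqrt[OF metric_inner_pos[OF nz]] this] show ?thesis
    unfolding metric_norm_def by (rule DERIV_cong) (simp add: field_simps)
qed

definition speed :: "real^2 \<Rightarrow> real \<Rightarrow> real^2 \<Rightarrow> real" where
  "speed p s v = nrm (p + catenary s v) (catenary_velocity s v)"

definition arclength :: "real^2 \<Rightarrow> real \<Rightarrow> real^2 \<Rightarrow> real" where
  "arclength p s v = s * integral {0..1} (\<lambda>t. speed p (t * s) v)"

lemma speed_pos: "v \<noteq> 0 \<Longrightarrow> speed p s v > 0"
  by (simp add: speed_def metric_norm_pos catenary_velocity_nonzero)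

lemma speed_scaleR: "r \<ge> 0 \<Longrightarrow> speed p s (r *\<^sub>R v) = r * speed p (s * r) v"
  by (simp add: speed_def catenary_scaleR catenary_velocity_scaleR metric_norm_scaleR)

lemma arclength_scaleR: "r \<ge> 0 \<Longrightarrow> arclength p s (r *\<^sub>R v) = arclength p (s * r) v"
  by (simp add: arclength_def speed_scaleR mult.assoc)

lemma speed_has_derivative:
  assumes "v \<noteq> 0"
  shows "((\<lambda>s. speed p s v) has_real_derivative
    metric_inner g (torus_proj (p + catenary s v)) (catenary_velocity s v)
      (vector [- norm (catenary_velocity s v) * v $ 2, 0]
        + Gam (torus_proj (p + catenary s v)) (catenary_velocity s v)) / speed p s v) (at s)"
  unfolding speed_def
  by (intro nrm_has_derivative catenary_velocity_has_derivative catenary_velocity_nonzero[OF assms])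
    (auto intro!: derivative_eq_intros catenary_has_derivative)

lemma C1_on_speed:
  fixes s :: "'a::euclidean_space \<Rightarrow> real"
  assumes "C1_on s S" "C1_on v S" "\<And>x. x \<in> S \<Longrightarrow> v x \<noteq> 0"
  shows "C1_on (\<lambda>x. speed p (s x) (v x)) S"
  unfolding speed_def
  by (intro C1_on_nrm C1_on_add C1_on_const C1_on_catenary C1_on_catenary_velocity assms
      catenary_velocity_nonzero)

lemma continuous_on_speed: "v \<noteq> 0 \<Longrightarrow> continuous_on S (\<lambda>s. speed p s v)"
  by (rule C1_on_imp_continuous_on[OF C1_on_speed[OF C1_on_ident C1_on_const]])

lemma arclength_has_derivative:
  assumes "v \<noteq> 0"
  shows "((\<lambda>s. arclength p s v) has_real_derivative speed p s v) (at s)"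
  using has_vector_derivative_scaled_integral[OF continuous_on_speed[OF assms], of p s]
  by (simp add: arclength_def has_real_derivative_iff_has_vector_derivative)

lemma arclength_0 [simp]: "arclength p 0 v = 0"
  by (simp add: arclength_def)

lemma arclength_strict_mono:
  assumes "v \<noteq> 0" "s < s'"
  shows "arclength p s v < arclength p s' v"
  using DERIV_pos_imp_increasing[OF assms(2), of "\<lambda>s. arclength p s v"]
    arclength_has_derivative[OF assms(1)] speed_pos[OF assms(1)] by blast

text \<open>The speed is at least some \<open>d > 0\<close> for all \<open>s\<close>, so subtracting
  \<open>d * s\<close> leaves a nondecreasing function. Thus the arc length at
  \<open>- \<bar>t\<bar> / d\<close> and at \<open>\<bar>t\<bar> / d\<close> encloses
  \<open>t\<close>.\<close>

lemma bij_arclength: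
  assumes v: "v \<noteq> 0"
  shows "bij (\<lambda>s. arclength p s v)"
proof (rule bijI)
  show "inj (\<lambda>s. arclength p s v)"
    using arclength_strict_mono[OF v] by (intro linorder_injI) (metis less_irrefl)
  obtain m where m: "m > 0" "\<And>x v. m * norm v \<le> metric_norm g x v" by (rule metric_norm_lower) blast
  obtain k where k: "k > 0" "\<And>s. k \<le> norm (catenary_velocity s v)"
    using catenary_velocity_lower[OF v] by blast
  define d where "d = m * k"
  have d: "d > 0" using m k by (simp add: d_def)
  have dle: "d \<le> speed p s v" for s
    using order_trans[OF mult_left_mono[OF k(2), of m] m(2)] m(1) by (simp add: d_def speed_def)
  have mono: "arclength p s v - d * s \<le> arclength p s' v - d * s'" if "s \<le> s'" for s s'
  proof (rule DERIV_nonneg_imp_nondecreasing[OF that])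
    fix x
    have "((\<lambda>s. arclength p s v - d * s) has_real_derivative speed p x v - d) (at x)"
      by (auto intro!: derivative_eq_intros arclength_has_derivative v)
    then show "\<exists>y. ((\<lambda>s. arclength p s v - d * s) has_real_derivative y) (at x) \<and> 0 \<le> y"
      using dle[of x] by auto
  qed
  have "\<exists>s. arclength p s v = t" for t
  proof -
    define R where "R = \<bar>t\<bar> / d"
    have R: "R \<ge> 0" "d * R = \<bar>t\<bar>" using d by (auto simp: R_def)
    have "arclength p (- R) v \<le> t" "t \<le> arclength p R v"
      using mono[of "- R" 0] mono[of 0 R] R by auto
    moreover have "isCont (\<lambda>s. arclength p s v) x" for x
      by (rule DERIV_isCont[OF arclength_has_derivative[OF v]])
    ultimately show ?thesis
      using IVT[of "\<lambda>s. arclength p s v" "- R" t R] R by auto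
  qed
  then show "surj (\<lambda>s. arclength p s v)" by (metis surj_def)
qed

definition arcparam :: "real^2 \<Rightarrow> real^2 \<Rightarrow> real \<Rightarrow> real" where
  "arcparam p v = inv (\<lambda>s. arclength p s v)"

lemma arclength_arcparam: "v \<noteq> 0 \<Longrightarrow> arclength p (arcparam p v t) v = t"
  unfolding arcparam_def using surj_f_inv_f[OF bij_is_surj[OF bij_arclength]] by simp

lemma arcparam_arclength: "v \<noteq> 0 \<Longrightarrow> arcparam p v (arclength p s v) = s"
  unfolding arcparam_def using inv_f_f[OF bij_is_inj[OF bij_arclength]] by simp

lemma arcparam_has_derivative:
  assumes v: "v \<noteq> 0"
  shows "(arcparam p v has_real_derivative inverse (speed p (arcparam p v t) v)) (at t)"
proof -
  have "(arcparam p v has_real_derivative inverse (speed p (arcparam p v t) v))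
      (at (arclength p (arcparam p v t) v))"
    unfolding has_field_derivative_def
  proof (rule has_derivative_inverse_strong[OF open_UNIV UNIV_I,
        where f="\<lambda>s. arclength p s v" and x="arcparam p v t"])
    show "continuous_on UNIV (\<lambda>s. arclength p s v)"
      by (intro continuous_at_imp_continuous_on ballI DERIV_isCont[OF arclength_has_derivative[OF v]])
    show "((\<lambda>s. arclength p s v) has_derivative (*) (speed p (arcparam p v t) v))
        (at (arcparam p v t))"
      using arclength_has_derivative[OF v] by (simp add: has_field_derivative_def)
    show "(*) (speed p (arcparam p v t) v) \<circ> (*) (inverse (speed p (arcparam p v t) v)) = id"
      using speed_pos[OF v, of p "arcparam p v t"] by (simp add: fun_eq_iff)
  qed (simp add: arcparam_arclength v)
  then show ?thesis by (simp add: arclength_arcparam v)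
qed

section \<open>The thermostat flow and its exponential map\<close>

text \<open>The unit vector itself serves as initial velocity of the catenary. By
  \<open>bij_arclength\<close> the parameter \<open>s\<close> exists for every \<open>t\<close>, so
  orbits are defined for all times.\<close>

definition catenary_flow :: "real \<Rightarrow> torus \<times> (real^2) \<Rightarrow> torus \<times> (real^2)" where
  "catenary_flow t z = (let p = torus_rep (fst z); v = snd z; s = arcparam p v t
     in (torus_proj (p + catenary s v), (1 / speed p s v) *\<^sub>R catenary_velocity s v))"

lemma catenary_unit:
  assumes "v \<noteq> 0"
  shows "nrm (p + catenary s v) ((1 / speed p s v) *\<^sub>R catenary_velocity s v) = 1"
  using speed_pos[OF assms, of p s] by (simp add: metric_norm_scaleR) (simp add: speed_def)

text \<open>The second component is the derivative of \<open>w / r\<close> by arc length, that is,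
  by \<open>s\<close> and then divided by \<open>r\<close>. Orthogonality expresses the constant
  unit length. The area condition survives the change of parameter because both sides scale with
  \<open>r ^ 3\<close> and the multiple of \<open>w\<close> spans no area with
  \<open>w\<close>.\<close>

lemma catenary_thermostat_field:
  fixes p v :: "real^2" and s :: real
  assumes v: "v \<noteq> 0"
  defines "q \<equiv> p + catenary s v" and "w \<equiv> catenary_velocity s v" and "r \<equiv> speed p s v"
  defines "w' \<equiv> vector [- norm w * v $ 2, 0] :: real^2"
  defines "r' \<equiv> metric_inner g (torus_proj q) w (w' + Gam (torus_proj q) w) / r"
  shows "thermostat_field g catenary_lambda (torus_proj q, (1 / r) *\<^sub>R w)
    = ((1 / r) *\<^sub>R w, (1 / r\<^sup>2) *\<^sub>R w' - (r' / r ^ 3) *\<^sub>R w)"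
proof (rule thermostat_field_eqI)
  have r: "r > 0" unfolding r_def by (rule speed_pos[OF v])
  show "nrm q ((1 / r) *\<^sub>R w) = 1"
    unfolding q_def r_def w_def by (rule catenary_unit[OF v])
  have rr: "metric_inner g (torus_proj q) w w = r\<^sup>2"
    by (simp add: r_def speed_def metric_norm_square flip: q_def w_def)
  have e: "metric_inner g (torus_proj q) w w'
      = r * r' - metric_inner g (torus_proj q) w (Gam (torus_proj q) w)"
    using r by (simp add: r'_def metric_inner_add_right)
  have eq: "(1 / r\<^sup>2) *\<^sub>R w' - (r' / r ^ 3) *\<^sub>R w + Gam (torus_proj q) ((1 / r) *\<^sub>R w)
      = (1 / r\<^sup>2) *\<^sub>R (w' + Gam (torus_proj q) w) + (- r' / r ^ 3) *\<^sub>R w"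
    by (simp add: Gam_scaleR power_divide scaleR_add_right)
  show "metric_inner g (torus_proj q) ((1 / r) *\<^sub>R w)
      ((1 / r\<^sup>2) *\<^sub>R w' - (r' / r ^ 3) *\<^sub>R w + Gam (torus_proj q) ((1 / r) *\<^sub>R w)) = 0"
    unfolding eq metric_inner_add_right metric_inner_scaleR rr e
    using r by (simp add: field_simps power2_eq_square power3_eq_cube)
  have "w $ 2 = v $ 2" by (simp add: w_def)
  then show "((1 / r) *\<^sub>R w) $ 1 * ((1 / r\<^sup>2) *\<^sub>R w' - (r' / r ^ 3) *\<^sub>R w) $ 2
      - ((1 / r) *\<^sub>R w) $ 2 * ((1 / r\<^sup>2) *\<^sub>R w' - (r' / r ^ 3) *\<^sub>R w) $ 1
      = norm ((1 / r) *\<^sub>R w) * (((1 / r) *\<^sub>R w) $ 2)\<^sup>2"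
    using r by (simp add: w'_def field_simps power2_eq_square power3_eq_cube)
qed

lemma catenary_flow_velocity:
  assumes v: "v \<noteq> 0"
  shows "has_velocity (\<lambda>t. catenary_flow t (x, v))
    (thermostat_field g catenary_lambda (catenary_flow t (x, v))) t"
proof -
  define p where "p = torus_rep x"
  define s where "s = arcparam p v t"
  define w where "w = catenary_velocity s v"
  define r where "r = speed p s v"
  define w' :: "real^2" where "w' = vector [- norm w * v $ 2, 0]"
  define r' where "r' = metric_inner g (torus_proj (p + catenary s v)) w
      (w' + Gam (torus_proj (p + catenary s v)) w) / r"
  have r: "r > 0" unfolding r_def by (rule speed_pos[OF v])
  have flow: "catenary_flow u (x, v) = (torus_proj (p + catenary (arcparam p v u) v),
      (1 / speed p (arcparam p v u) v) *\<^sub>R catenary_velocity (arcparam p v u) v)" for u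
    by (simp add: catenary_flow_def Let_def p_def)
  have field: "thermostat_field g catenary_lambda (catenary_flow t (x, v))
      = ((1 / r) *\<^sub>R w, (1 / r\<^sup>2) *\<^sub>R w' - (r' / r ^ 3) *\<^sub>R w)"
    unfolding flow s_def[symmetric] r_def[symmetric] w_def[symmetric]
    unfolding r'_def w'_def r_def w_def by (rule catenary_thermostat_field[OF v])
  have ds: "(arcparam p v has_vector_derivative 1 / r) (at t)"
    using arcparam_has_derivative[OF v, of p t]
    by (simp add: has_real_derivative_iff_has_vector_derivative r_def s_def inverse_eq_divide)
  have comp: "((\<lambda>u. f (arcparam p v u)) has_vector_derivative (1 / r) *\<^sub>R f') (at t)"
    if "(f has_vector_derivative f') (at s)" for f :: "real \<Rightarrow> real^2" and f'
    using vector_diff_chain_at[OF ds, of f f'] that by (simp add: s_def o_def)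
  have "((\<lambda>s. p + catenary s v) has_vector_derivative w) (at s)"
    unfolding w_def by (auto intro!: derivative_eq_intros catenary_has_derivative)
  note dq = comp[OF this]
  have "((\<lambda>s. speed p s v) has_real_derivative r') (at s)"
    using speed_has_derivative[OF v, of p s] by (simp add: r'_def w'_def w_def r_def)
  then have "((\<lambda>s. 1 / speed p s v) has_real_derivative - (r' / r\<^sup>2)) (at s)"
    using r by (auto intro!: derivative_eq_intros simp: r_def power2_eq_square)
  from has_vector_derivative_scaleR[OF this catenary_velocity_has_derivative]
  have "((\<lambda>s. (1 / speed p s v) *\<^sub>R catenary_velocity s v) has_vector_derivative
      (1 / r) *\<^sub>R w' + (- (r' / r\<^sup>2)) *\<^sub>R w) (at s)"
    by (simp add: r_def w'_def w_def)
  from comp[OF this] have dw: "((\<lambda>u. snd (catenary_flow u (x, v))) has_vector_derivative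
      (1 / r\<^sup>2) *\<^sub>R w' - (r' / r ^ 3) *\<^sub>R w) (at t)"
    unfolding flow snd_conv
    by (rule has_vector_derivative_eq_rhs)
      (simp add: scaleR_diff_right power2_eq_square power3_eq_cube mult.commute mult.left_commute)
  show ?thesis
    unfolding has_velocity_def field fst_conv
    using dq dw
    by (intro conjI exI[of _ "\<lambda>u. p + catenary (arcparam p v u) v"]) (simp_all add: flow)
qed

lemma unit_tangent_nonzero: "(x, v) \<in> unit_tangent g \<Longrightarrow> v \<noteq> 0"
  by (auto simp: unit_tangent_def metric_norm_def metric_inner_def)

lemma catenary_flow_is_thermostat_flow: "is_thermostat_flow g catenary_lambda catenary_flow"
  unfolding is_thermostat_flow_def
proof (intro ballI)
  fix z assume z: "z \<in> unit_tangent g"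
  obtain x v where zxv: "z = (x, v)" by (cases z)
  have v: "v \<noteq> 0" using unit_tangent_nonzero z zxv by blast
  have "arcparam (torus_rep x) v 0 = 0"
    using arcparam_arclength[OF v, of _ 0] by simp
  then have "catenary_flow 0 z = z"
    using z by (simp add: catenary_flow_def zxv Let_def torus_proj_rep speed_def unit_tangent_def)
  moreover have "catenary_flow t z \<in> unit_tangent g" for t
    using catenary_unit[OF v] by (simp add: catenary_flow_def zxv Let_def unit_tangent_def)
  ultimately show "catenary_flow 0 z = z \<and> (\<forall>t. catenary_flow t z \<in> unit_tangent g \<and>
      has_velocity (\<lambda>s. catenary_flow s z)
        (thermostat_field g catenary_lambda (catenary_flow t z)) t)"
    using catenary_flow_velocity[OF v, of x] by (simp add: zxv)
qed

section \<open>The exponential map through the two maps \<open>E\<close> and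
  \<open>H\<close>\<close>

definition arc_end :: "real^2 \<Rightarrow> real^2 \<Rightarrow> real^2" where
  "arc_end p u = p + catenary 1 u"

text \<open>The map \<open>H\<close>: the positive multiple of \<open>u\<close> whose
  \<open>g\<close>-length is that of the catenary arc. At \<open>u = 0\<close> the last factor makes
  the value 0, whatever the quotient is.\<close>

definition arc_length_vector :: "real^2 \<Rightarrow> real^2 \<Rightarrow> real^2" where
  "arc_length_vector p u = (arclength p 1 u / nrm p u) *\<^sub>R u"

text \<open>For the unit vector \<open>v = u / n\<close>, the arc of \<open>u\<close> over [0, 1] is
  the arc of \<open>v\<close> over [0, n]. Its length \<open>L\<close> is both the flow time and the
  norm of the argument.\<close>

lemma thermostat_exp_arc:
  "thermostat_exp g catenary_flow x (arc_length_vector (torus_rep x) u)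
    = torus_proj (arc_end (torus_rep x) u)"
proof (cases "u = 0")
  case True
  then show ?thesis
    using catenary_scaleR[of 0 1 u]
    by (simp add: thermostat_exp_def arc_length_vector_def arc_end_def torus_proj_rep)
next
  case u: False
  define p where "p = torus_rep x"
  define n where "n = nrm p u"
  define L where "L = arclength p 1 u"
  have x: "torus_proj p = x" by (simp add: p_def torus_proj_rep)
  have n: "n > 0" unfolding n_def by (rule metric_norm_pos[OF u])
  have L: "L > 0" using arclength_strict_mono[OF u, of 0 1 p] by (simp add: L_def)
  define v where "v = (1 / n) *\<^sub>R u"
  have v: "v \<noteq> 0" "u = n *\<^sub>R v" using u n by (auto simp: v_def)
  have "arclength p n v = L"
    using arclength_scaleR[of n p 1 v] n v(2) by (simp add: L_def)
  then have s: "arcparam p v L = n" using arcparam_arclength[OF v(1), of p n] by simp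
  have H: "arc_length_vector p u = (L / n) *\<^sub>R u" by (simp add: arc_length_vector_def L_def n_def)
  have N: "metric_norm g x ((L / n) *\<^sub>R u) = L"
    using n L by (simp add: metric_norm_scaleR n_def x)
  have "thermostat_exp g catenary_flow x (arc_length_vector p u)
      = fst (catenary_flow L (x, (1 / L) *\<^sub>R (L / n) *\<^sub>R u))"
    using n L u by (simp add: thermostat_exp_def H N)
  also have "(1 / L) *\<^sub>R (L / n) *\<^sub>R u = v" using L by (simp add: v_def)
  also have "fst (catenary_flow L (x, v)) = torus_proj (p + catenary n v)"
    by (simp add: catenary_flow_def Let_def s flip: p_def)
  also have "catenary n v = catenary 1 u"
    using catenary_scaleR[of n 1 v] n v(2) by simp
  finally show ?thesis by (simp add: arc_end_def p_def)
qed

lemma surj_arc_length_vector: "surj (arc_length_vector p)"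
proof -
  have "\<exists>u. arc_length_vector p u = w" for w
  proof (cases "w = 0")
    case True
    then show ?thesis by (intro exI[of _ 0]) (simp add: arc_length_vector_def)
  next
    case w: False
    \<comment> \<open>Follow the catenary with initial velocity \<open>w\<close> until its length is
      \<open>nrm p w\<close>; then \<open>s *\<^sub>R w\<close> is sent to the vector of that length
      in the direction of \<open>w\<close>.\<close>
    define s where "s = arcparam p w (nrm p w)"
    have L: "arclength p s w = nrm p w" by (simp add: s_def arclength_arcparam w)
    have "s > 0"
      using arclength_strict_mono[OF w, of s 0 p] metric_norm_pos[OF w, of "torus_proj p"] L
      by (cases s "0 :: real" rule: linorder_cases) auto
    then have "arc_length_vector p (s *\<^sub>R w) = w"
      using arclength_scaleR[of s p 1 w] L metric_norm_pos[OF w, of "torus_proj p"]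
      by (simp add: arc_length_vector_def metric_norm_scaleR)
    then show ?thesis by blast
  qed
  then show ?thesis by (metis surj_def)
qed

lemma arc_end_C1: "C1_on (arc_end p) UNIV"
proof -
  \<comment> \<open>The mean velocity over an arc; at radius 0 it is the initial velocity, as
    \<open>C1_polar\<close> asks.\<close>
  define M where "M z = integral {0..1} (\<lambda>t. catenary_velocity (t * fst z) (snd z))" for z
  have "C1_on M (UNIV \<times> - {0})"
    unfolding M_def by (rule C1_on_catenary_mean)
  moreover have "M (0, w) = w" for w by (simp add: M_def)
  ultimately have F: "C1_on (\<lambda>u. norm u *\<^sub>R M (norm u, u /\<^sub>R norm u)) UNIV"
    by (intro C1_polar(1)) auto
  have "catenary 1 u = norm u *\<^sub>R M (norm u, u /\<^sub>R norm u)" for u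
  proof (cases "u = 0")
    case True
    then show ?thesis using catenary_scaleR[of 0 1 u] by simp
  next
    case False
    then show ?thesis
      using catenary_scaleR[of "norm u" 1 "u /\<^sub>R norm u"] by (simp add: catenary_def M_def)
  qed
  then have "arc_end p = (\<lambda>u. p + norm u *\<^sub>R M (norm u, u /\<^sub>R norm u))"
    by (simp add: arc_end_def fun_eq_iff)
  then show ?thesis using C1_on_add[OF C1_on_const F, of p] by simp
qed

lemma arc_length_vector_C1:
  "C1_on (arc_length_vector p) UNIV"
  "(arc_length_vector p has_derivative (\<lambda>h. h)) (at 0)"
proof -
  \<comment> \<open>Ratio of mean speed to initial speed, times the direction; at radius 0 the ratio
    is 1.\<close>
  define M where "M z = (integral {0..1} (\<lambda>t. speed p (t * fst z) (snd z))
      * inverse (nrm p (snd z))) *\<^sub>R snd z" for z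
  have "C1_on M (UNIV \<times> - {0})"
    unfolding M_def
    by (intro C1_on_scaleR C1_on_mult C1_on_integral C1_on_speed C1_on_inverse C1_on_nrm
        C1_on_fst C1_on_snd C1_on_ident C1_on_const open_Times)
      (auto dest: metric_norm_pos[of _ "torus_proj p"])
  moreover have "M (0, w) = w" if "w \<noteq> 0" for w
    using metric_norm_pos[OF that, of "torus_proj p"] by (simp add: M_def speed_def)
  ultimately have F: "C1_on (\<lambda>u. norm u *\<^sub>R M (norm u, u /\<^sub>R norm u)) UNIV"
    "((\<lambda>u. norm u *\<^sub>R M (norm u, u /\<^sub>R norm u)) has_derivative (\<lambda>h. h)) (at 0)"
    using C1_polar[of M] by blast+
  have "arc_length_vector p u = norm u *\<^sub>R M (norm u, u /\<^sub>R norm u)" for u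
  proof (cases "u = 0")
    case True
    then show ?thesis by (simp add: arc_length_vector_def)
  next
    case False
    define w where "w = u /\<^sub>R norm u"
    have u: "u = norm u *\<^sub>R w" using False by (simp add: w_def)
    have "arclength p 1 u = arclength p (norm u) w"
      using arclength_scaleR[of "norm u" p 1 w] u by simp
    moreover have "nrm p u = norm u * nrm p w"
      using metric_norm_scaleR[of "torus_proj p" "norm u" w] u by simp
    moreover have "nrm p w > 0" using False by (intro metric_norm_pos) (auto simp: w_def)
    ultimately show ?thesis
      using False by (simp add: arc_length_vector_def M_def arclength_def divide_inverse
          flip: w_def) (simp add: w_def)
  qed
  then have eq: "arc_length_vector p = (\<lambda>u. norm u *\<^sub>R M (norm u, u /\<^sub>R norm u))"
    by (simp add: fun_eq_iff)
  show "C1_on (arc_length_vector p) UNIV"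
    "(arc_length_vector p has_derivative (\<lambda>h. h)) (at 0)"
    unfolding eq by (rule F)+
qed

text \<open>The map multiplies \<open>u\<close> by a scalar \<open>\<rho> u > 0\<close>, so a vector
  in the kernel must be radial. Along the ray only the end point moves on a fixed catenary, and the
  length grows at the rate \<open>speed p 1 u > 0\<close>.\<close>

lemma arc_length_vector_deriv_inj:
  assumes D: "(arc_length_vector p has_derivative D) (at u)" and h: "D h = 0"
  shows "h = 0"
proof (cases "u = 0")
  case True
  then show ?thesis
    using has_derivative_unique[OF D] arc_length_vector_C1(2)[of p] h by (metis (no_types))
next
  case u: False
  define \<rho> where "\<rho> u = arclength p 1 u * inverse (nrm p u)" for u
  have "C1_on \<rho> (- {0})"
    unfolding \<rho>_def arclength_def
    by (intro C1_on_mult C1_on_integral C1_on_speed C1_on_inverse C1_on_nrm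
        C1_on_fst C1_on_snd C1_on_ident C1_on_const)
      (auto dest: metric_norm_pos[of _ "torus_proj p"])
  then obtain \<rho>' where \<rho>': "(\<rho> has_derivative \<rho>') (at u)"
    using u by (elim C1_onE) blast
  have eq: "arc_length_vector p = (\<lambda>u. \<rho> u *\<^sub>R u)"
    by (simp add: fun_eq_iff arc_length_vector_def \<rho>_def divide_inverse)
  have "(arc_length_vector p has_derivative (\<lambda>h. \<rho> u *\<^sub>R h + \<rho>' h *\<^sub>R u)) (at u)"
    unfolding eq by (rule has_derivative_scaleR[OF \<rho>' has_derivative_ident])
  then have D_eq: "D = (\<lambda>h. \<rho> u *\<^sub>R h + \<rho>' h *\<^sub>R u)"
    by (rule has_derivative_unique[OF D])
  have pos: "\<rho> u > 0" "nrm p u > 0" "speed p 1 u > 0"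
    using arclength_strict_mono[OF u, of 0 1 p] metric_norm_pos[OF u] speed_pos[OF u]
    by (simp_all add: \<rho>_def)
  define \<tau> where "\<tau> = - \<rho>' h / \<rho> u"
  have "h = \<tau> *\<^sub>R u"
  proof -
    have "\<rho> u *\<^sub>R h = \<rho> u *\<^sub>R \<tau> *\<^sub>R u"
      using h pos by (simp add: D_eq \<tau>_def eq_neg_iff_add_eq_0)
    then show ?thesis using pos(1) by (metis less_irrefl scaleR_left_imp_eq)
  qed
  have "D u = (speed p 1 u / nrm p u) *\<^sub>R u"
  proof -
    have "((\<lambda>s. s *\<^sub>R u) has_vector_derivative u) (at 1)"
      by (auto intro!: derivative_eq_intros)
    then have "((\<lambda>s. arc_length_vector p (s *\<^sub>R u)) has_vector_derivative D u) (at 1)"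
      using vector_derivative_diff_chain_within[of "\<lambda>s. s *\<^sub>R u" u 1 UNIV "arc_length_vector p" D]
        has_derivative_at_withinI[OF D]
      by (simp add: o_def)
    moreover have "((\<lambda>s. arc_length_vector p (s *\<^sub>R u)) has_vector_derivative
        (speed p 1 u / nrm p u) *\<^sub>R u) (at 1)"
    proof (rule has_vector_derivative_transform_within_open[of _ _ _ "{0<..}"])
      have "((\<lambda>s. arclength p s u / nrm p u) has_real_derivative speed p 1 u / nrm p u) (at 1)"
        by (intro DERIV_cdivide arclength_has_derivative u)
      from has_vector_derivative_scaleR[OF this has_vector_derivative_const]
      show "((\<lambda>s. (arclength p s u / nrm p u) *\<^sub>R u) has_vector_derivative
          (speed p 1 u / nrm p u) *\<^sub>R u) (at 1)"
        by simp
      show "(arclength p s u / nrm p u) *\<^sub>R u = arc_length_vector p (s *\<^sub>R u)" if "s \<in> {0<..}" for s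
        using that arclength_scaleR[of s p 1 u]
        by (simp add: arc_length_vector_def metric_norm_scaleR)
    qed auto
    ultimately show ?thesis by (rule vector_derivative_unique_at)
  qed
  moreover have "D (\<tau> *\<^sub>R u) = \<tau> *\<^sub>R D u"
    by (rule linear_scale[OF has_derivative_linear[OF D]])
  ultimately have "\<tau> = 0" using h \<open>h = \<tau> *\<^sub>R u\<close> pos u by auto
  then show ?thesis using \<open>h = \<tau> *\<^sub>R u\<close> by simp
qed

section \<open>Nondegeneracy of the derivative of \<open>E\<close>\<close>

lemma catenary_nth_2: "catenary 1 u $ 2 = u $ 2"
proof -
  have "(\<lambda>t. catenary_velocity t u) integrable_on {0..1}"
    by (intro integrable_continuous_real continuous_on_catenary_velocity)
  from integral_linear[OF this bounded_linear_vec_nth, of 2] show ?thesis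
    by (simp add: catenary_def o_def)
qed

text \<open>A bound on increments instead of derivatives uses only that the norm is 1-Lipschitz and
  so covers \<open>u = 0\<close>. The integrand gains at least
  \<open>\<tau> * (cosh x - \<bar>sinh x\<bar>)\<close> with \<open>x = u $ 2 * t\<close>, which is
  \<open>\<tau> * exp (- \<bar>x\<bar>)\<close>.\<close>

lemma catenary_nth_1_mono:
  assumes "\<tau> > 0"
  shows "catenary 1 u $ 1 + \<tau> * exp (- \<bar>u $ 2\<bar>) \<le> catenary 1 (u + \<tau> *\<^sub>R axis 1 1) $ 1"
proof -
  have int: "(\<lambda>t. catenary_velocity t v $ 1) integrable_on {0..1}" for v
    using integrable_linear[OF integrable_continuous_real[OF continuous_on_catenary_velocity]
        bounded_linear_vec_nth] by (simp only: o_def)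
  have eq: "catenary 1 v $ 1 = integral {0..1} (\<lambda>t. catenary_velocity t v $ 1)" for v
  proof -
    have "integral {0..1} ((\<lambda>w. w $ 1) \<circ> (\<lambda>t. catenary_velocity t v))
        = integral {0..1} (\<lambda>t. catenary_velocity t v) $ 1"
      by (rule integral_linear[OF integrable_continuous_real[OF continuous_on_catenary_velocity]
            bounded_linear_vec_nth])
    then show ?thesis by (simp only: catenary_def o_def mult_1_right scaleR_one)
  qed
  define u' where "u' = u + \<tau> *\<^sub>R axis 1 1"
  have "integral {0..1} (\<lambda>t. catenary_velocity t u $ 1 + \<tau> * exp (- \<bar>u $ 2\<bar>))
      \<le> integral {0..1} (\<lambda>t. catenary_velocity t u' $ 1)"
  proof (rule integral_le)
    show "(\<lambda>t. catenary_velocity t u $ 1 + \<tau> * exp (- \<bar>u $ 2\<bar>)) integrable_on {0..1}"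
      by (intro integrable_add int integrable_const_ivl)
    show "(\<lambda>t. catenary_velocity t u' $ 1) integrable_on {0..1}" by (rule int)
    fix t :: real assume t: "t \<in> {0..1}"
    define c h where "c = cosh (u $ 2 * t)" and "h = sinh (u $ 2 * t)"
    have "\<bar>norm u' - norm u\<bar> \<le> \<tau>"
      using norm_triangle_ineq3[of u' u] assms by (simp add: u'_def norm_axis_1)
    then have "(norm u' - norm u) * h \<le> \<tau> * \<bar>h\<bar>"
      by (metis abs_ge_self abs_ge_zero abs_mult mult_right_mono order_trans)
    moreover have "\<tau> * exp (- \<bar>u $ 2\<bar>) \<le> \<tau> * (c - \<bar>h\<bar>)"
    proof -
      have "\<bar>u $ 2 * t\<bar> \<le> \<bar>u $ 2\<bar> * 1" unfolding abs_mult using t by (intro mult_left_mono) auto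
      then show ?thesis
        using assms by (simp add: c_def h_def cosh_minus_abs_sinh)
    qed
    ultimately have "\<tau> * exp (- \<bar>u $ 2\<bar>) \<le> \<tau> * c - (norm u' - norm u) * h"
      by (simp add: algebra_simps)
    moreover have "u' $ 1 = u $ 1 + \<tau>" "u' $ 2 = u $ 2" by (simp_all add: u'_def axis_def)
    ultimately show "catenary_velocity t u $ 1 + \<tau> * exp (- \<bar>u $ 2\<bar>) \<le> catenary_velocity t u' $ 1"
      by (simp add: c_def h_def algebra_simps)
  qed
  also have "integral {0..1} (\<lambda>t. catenary_velocity t u $ 1 + \<tau> * exp (- \<bar>u $ 2\<bar>))
      = catenary 1 u $ 1 + \<tau> * exp (- \<bar>u $ 2\<bar>)"
    using integral_add[OF int integrable_const_ivl] by (simp add: eq del: catenary_velocity_nth)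
  finally show ?thesis by (simp only: eq u'_def)
qed

text \<open>The derivative is triangular: the second component forces \<open>h $ 2 = 0\<close>, and
  the first diagonal entry is a limit of one-sided quotients bounded below by
  \<open>catenary_nth_1_mono\<close>.\<close>

lemma arc_end_deriv_inj:
  assumes D: "(arc_end p has_derivative D) (at u)" and h: "D h = 0"
  shows "h = 0"
proof -
  have lin: "linear D" by (rule has_derivative_linear[OF D])
  have "((\<lambda>u. arc_end p u $ 2) has_derivative (\<lambda>h. D h $ 2)) (at u)"
    by (rule bounded_linear.has_derivative[OF bounded_linear_vec_nth D])
  moreover have "((\<lambda>u. arc_end p u $ 2) has_derivative (\<lambda>h. h $ 2)) (at u)"
    by (auto simp: arc_end_def catenary_nth_2 intro!: derivative_eq_intros
        bounded_linear_imp_has_derivative bounded_linear_vec_nth)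
  ultimately have "(\<lambda>h. D h $ 2) = (\<lambda>h. h $ 2)" by (rule has_derivative_unique)
  then have h2: "h $ 2 = 0" using h by (metis zero_index)
  define e :: "real^2" where "e = axis 1 1"
  have he: "h = h $ 1 *\<^sub>R e" using h2 by (simp add: vec_eq_iff forall_2 e_def axis_def)
  have "((\<lambda>\<tau>. u + \<tau> *\<^sub>R e) has_vector_derivative e) (at 0)"
    by (auto intro!: derivative_eq_intros)
  then have "((\<lambda>\<tau>. arc_end p (u + \<tau> *\<^sub>R e)) has_vector_derivative D e) (at 0)"
    using vector_derivative_diff_chain_within[of "\<lambda>\<tau>. u + \<tau> *\<^sub>R e" e 0 UNIV "arc_end p" D]
      has_derivative_at_withinI[OF D]
    by (simp add: o_def)
  from bounded_linear.has_vector_derivative[OF bounded_linear_vec_nth this, of 1]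
  have "((\<lambda>\<tau>. arc_end p (u + \<tau> *\<^sub>R e) $ 1) has_real_derivative D e $ 1) (at 0)"
    by (simp add: has_real_derivative_iff_has_vector_derivative)
  then have "((\<lambda>\<tau>. (arc_end p (u + \<tau> *\<^sub>R e) $ 1 - arc_end p u $ 1) / \<tau>) \<longlongrightarrow> D e $ 1) (at_right 0)"
    using tendsto_mono[OF at_le[of "{0<..}" UNIV]] by (simp add: has_field_derivative_iff)
  moreover have "\<forall>\<^sub>F \<tau> in at_right 0. exp (- \<bar>u $ 2\<bar>)
      \<le> (arc_end p (u + \<tau> *\<^sub>R e) $ 1 - arc_end p u $ 1) / \<tau>"
    using catenary_nth_1_mono[of _ u]
    by (auto simp: eventually_at_filter arc_end_def e_def field_simps intro!: always_eventually)
  ultimately have "exp (- \<bar>u $ 2\<bar>) \<le> D e $ 1"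
    by (rule tendsto_lowerbound) simp
  then have "D e $ 1 > 0" by (rule less_le_trans[OF exp_gt_zero])
  moreover have "D h = h $ 1 *\<^sub>R D e" using linear_scale[OF lin, of "h $ 1" e] he by simp
  ultimately have "h $ 1 = 0" using h by (auto simp: vec_eq_iff)
  then show ?thesis using he by simp
qed

lemma no_conjugate_points_catenary: "no_conjugate_points g catenary_lambda"
  unfolding no_conjugate_points_def
  by (intro exI[of _ catenary_flow] conjI allI catenary_flow_is_thermostat_flow
      local_diffeoI[OF arc_length_vector_C1(1) arc_length_vector_deriv_inj arc_end_C1
        arc_end_deriv_inj surj_arc_length_vector thermostat_exp_arc])

text \<open>Antipodal vectors cancel the odd part of the curvature; the even part is nonnegative.\<close>

lemma fourier0_catenary_lambda: "fourier0 g catenary_lambda x \<noteq> 0"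
proof -
  define v :: "real^2" where "v = (1 / metric_norm g x (axis 1 1)) *\<^sub>R axis 1 1"
  define w where "w = rotJ g x v"
  define u where "u \<theta> = cos \<theta> *\<^sub>R v + sin \<theta> *\<^sub>R w" for \<theta>
  define f where "f \<theta> = catenary_lambda (x, u \<theta>)" for \<theta>
  define r where "r = sqrt (det (g x))"
  \<comment> \<open>Twice the even part of \<open>f\<close>; the Christoffel terms are cubic in the
    vector, hence odd.\<close>
  define k where "k \<theta> = 2 * r * (norm (u \<theta>) * (u \<theta> $ 2)\<^sup>2)" for \<theta>
  have "metric_norm g x (axis 1 1) > 0"
    by (rule metric_norm_pos) (simp add: axis_eq_0_iff)
  then have v: "v \<noteq> 0" "v $ 2 = 0" "v $ 1 > 0" by (auto simp: v_def axis_def vec_eq_iff)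
  have "v $ 1 * w $ 2 > 0"
    using rotJ_characterization(3)[OF metric v(1), of x] by (simp add: w_def v)
  then have w: "w $ 2 > 0" using v by (simp add: zero_less_mult_iff)
  have r: "r > 0"
    using gdet_pos[of "torus_rep x"] det_gram[of "torus_rep x"] by (simp add: r_def torus_proj_rep)
  have cu: "continuous_on S u" for S
    unfolding u_def by (intro continuous_intros)
  have cf: "continuous_on S f" for S
    unfolding f_def catenary_lambda_def Gam_def prod.case vec_lambda_beta
    by (intro continuous_intros cu)
  have ck: "continuous_on S k" for S
    unfolding k_def by (intro continuous_intros cu)
  have neg: "u (\<theta> + pi) = - u \<theta>" for \<theta> by (simp add: u_def)
  have even: "Gam x (- y) = Gam x y" for y
    by (simp add: Gam_def vec_eq_iff)
  have fk: "f \<theta> + f (\<theta> + pi) = k \<theta>" for \<theta>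
    unfolding f_def k_def catenary_lambda_def prod.case neg even
    by (simp add: r_def algebra_simps)
  have "integral {0..2 * pi} f = integral {0..pi} f + integral {pi..2 * pi} f"
    by (rule Henstock_Kurzweil_Integration.integral_combine[symmetric])
      (auto intro!: integrable_continuous_real cf)
  also have "integral {pi..2 * pi} f = integral {0..pi} (\<lambda>\<theta>. f (\<theta> + pi))"
    using integral_shift[OF cf, of 0 pi pi] by (simp add: o_def)
  also have "integral {0..pi} f + integral {0..pi} (\<lambda>\<theta>. f (\<theta> + pi)) = integral {0..pi} k"
    by (subst Henstock_Kurzweil_Integration.integral_add[symmetric])
      (auto simp: fk intro!: integrable_continuous_real cf
        continuous_on_compose2[OF cf] continuous_intros)
  finally have int: "integral {0..2 * pi} f = integral {0..pi} k" .
  have "integral {0..pi} k \<noteq> 0"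
  proof
    assume "integral {0..pi} k = 0"
    \<comment> \<open>A continuous nonnegative function with zero integral vanishes. The angle
      \<open>pi / 2\<close> gives the vector \<open>w\<close>, whose second component is positive
      because \<open>v\<close> is horizontal.\<close>
    then have "k (pi / 2) = 0"
      using integral_eq_0_iff[OF ck, of 0 pi] r by (simp add: k_def)
    then show False using r w by (auto simp: k_def u_def)
  qed
  then show ?thesis
    unfolding fourier0_def Let_def
    by (fold v_def, fold w_def, fold u_def, fold f_def) (simp add: int)
qed

end

theorem theorem1p4:
  fixes g :: "torus \<Rightarrow> real^2^2"
  assumes "riemannian_metric g"
  shows "(\<exists>l :: torus \<times> (real^2) \<Rightarrow> real.
            smooth_on_unit_tangent g l \<and> no_conjugate_points g l) \<and>
         (\<exists>l :: torus \<times> (real^2) \<Rightarrow> real.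
            smooth_on_unit_tangent g l \<and> no_conjugate_points g l \<and>
            (\<exists>x. fourier0 g l x \<noteq> 0))"
proof -
  interpret torus_metric g by unfold_locales (rule assms)
  show ?thesis
    using smooth_catenary_lambda no_conjugate_points_catenary fourier0_catenary_lambda by blast
qed

end
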